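(* For each $k\in\{1,\ldots,n\}$ (where $k$ may be fixed or may depend on $n$), the number of $n\times n$ diagonally symmetric alternating sign matrices whose $1$ in the first row is in column $k$ satisfies $$\lim_{n\to\infty}|\mathrm{DSASM}(n,k)|^{2/n^2}=\frac{3\sqrt3}{4}.$$
   Context: An alternating sign matrix (ASM) is a square matrix with entries in $\{0,1,-1\}$ such that along each row and each column the nonzero entries alternate in sign and have sum $1$; consequently its first row contains exactly one $1$ and all its other entries are $0$. A diagonally symmetric ASM (DSASM) is an ASM which equals its transpose. $\mathrm{DSASM}(n,k)$ denotes the set of $n\times n$ DSASMs whose unique $1$ in the first row is in column $k$. *)

theory Defs
  imports Complex_Main "Jordan_Normal_Form.Matrix"
begin

definition alternating_sign_list :: "int list \<Rightarrow> bool" where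
  "alternating_sign_list xs \<longleftrightarrow>
     set xs \<subseteq> {0, 1, -1} \<and>
     successively (\<lambda>x y. sgn y = - sgn x) (filter (\<lambda>x. x \<noteq> 0) xs) \<and>
     sum_list xs = 1"

definition alternating_sign_matrix :: "int mat \<Rightarrow> bool" where
  "alternating_sign_matrix A \<longleftrightarrow>
     square_mat A \<and>
     (\<forall>i < dim_row A. alternating_sign_list (list_of_vec (row A i))) \<and>
     (\<forall>j < dim_col A. alternating_sign_list (list_of_vec (col A j)))"

text \<open>The column index \<open>k\<close> is counted from 1, whereas matrix entries are indexed from 0.\<close>

definition DSASM :: "nat \<Rightarrow> nat \<Rightarrow> int mat set" where
  "DSASM n k = {A \<in> carrier_mat n n.
     alternating_sign_matrix A \<and> transpose_mat A = A \<and>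
     k \<in> {1..n} \<and> A $$ (0, k - 1) = 1}"

end

theory Submission
  imports Defs "Jordan_Normal_Form.Determinant" "HOL-Real_Asymp.Real_Asymp"
begin

text \<open>
Let \<open>X\<^sub>n\<close> be the number of alternating sign matrices of size \<open>n\<close>, and \<open>S\<^sub>n\<close> the number of
symmetric ones. The theorem says that the numbers of symmetric matrices with a prescribed
first row have the same growth as the square roots of the numbers \<open>X\<^sub>n\<close>, to
exponential order in \<open>n\<^sup>2\<close>. It follows from three facts.

The first one is that \<open>X\<^sub>n \<le> S\<^sub>n\<^sup>2\<close>, and \<open>S\<^sub>n\<^sup>2 \<le> (n + 1)\<^sup>2\<^sup>n\<^sup>+\<^sup>2 X\<^sub>n\<close>
(\<open>card_corner_sums_le\<close>, \<open>card_symmetric_corner_sums_le\<close>). An alternating sign matrix is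
encoded by its corner sums, which satisfy conditions on neighbouring positions only. An
arbitrary corner sum matrix therefore consists of an upper and a lower half that agree on the
diagonal and are otherwise independent, whereas a symmetric one is given by a single half; and
the diagonal takes too few values to matter.

The second one is that prescribing the position \<open>k\<close> of the 1 in the first row has no influence
on this scale: the number in question lies between \<open>S\<^sub>n\<^sub>-\<^sub>2\<close> and \<open>S\<^sub>n\<close>
(\<open>card_DSASM_ge\<close>, \<open>card_DSASM_le\<close>), because a symmetric matrix of size \<open>n - 2\<close> can be
enlarged by a transposition of the indices 1 and \<open>k\<close>, or by two fixed indices if \<open>k = 1\<close>.

The third one is that \<open>X\<^sub>n\<close> is \<open>(27 / 16)\<^sup>n\<^sup>(\<^sup>n\<^sup>-\<^sup>1\<^sup>)\<^sup>/\<^sup>2\<close> up to a factor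
of at most \<open>n!\<close> (\<open>card_corner_sums_bounds\<close>), and \<open>27 / 16\<close> is the square of
\<open>3 * sqrt 3 / 4\<close>. This comes from the recurrence
\<open>X\<^sub>n\<^sub>+\<^sub>1 / X\<^sub>n = n! (3 n + 1)! / ((2 n)! (2 n + 1)!)\<close> (\<open>card_corner_sums_Suc\<close>), that is,
from the enumeration of alternating sign matrices. It is obtained from the six-vertex model in
the way of Kuperberg, Okada and Stroganov: with weights depending on a parameter for each row
and each column, the sum over all alternating sign matrices is symmetric in the row
parameters by the Yang--Baxter equation, it has small degree in a column parameter, and it
reduces to a smaller grid when the first column parameter is \<open>\<omega>\<close> times a row parameter,
where \<open>\<omega>\<close> is a cube root of unity. A certain Schur polynomial, a quotient of an
alternant by a Vandermonde determinant, has the same properties, so the two agree up to a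
simple factor (\<open>partition_fn_eq_alternant\<close>). The Schur polynomial factors on geometric
progressions, and letting their ratio tend to 1 makes all weights equal
(\<open>partition_fn_homogeneous\<close>).
\<close>

section \<open>The six-vertex model at a cube root of unity\<close>

text \<open>Throughout, \<open>\<omega>\<close> is a primitive third root of unity. At this value of the
crossing parameter all six vertex weights coincide when the spectral parameters are
equal, so that the weighted count becomes a plain count.\<close>

definition omega :: complex ("\<omega>") where
  "\<omega> = cis (2 * pi / 3)"

lemma omega_cubed: "\<omega> ^ 3 = 1"
  by (simp add: omega_def Complex.DeMoivre)

lemma Im_omega: "Im \<omega> = sqrt 3 / 2"
  by (simp add: omega_def sin_120)

lemma omega_squared: "\<omega> ^ 2 = - 1 - \<omega>"
proof -
  have "(\<omega> - 1) * (\<omega> ^ 2 + \<omega> + 1) = \<omega> ^ 3 - 1"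
    by (simp add: algebra_simps power2_eq_square power3_eq_cube)
  then have "(\<omega> - 1) * (\<omega> ^ 2 + \<omega> + 1) = 0"
    by (simp add: omega_cubed)
  moreover have "\<omega> \<noteq> 1"
    using Im_omega by auto
  ultimately have "\<omega> ^ 2 + \<omega> + 1 = 0" by simp
  then show ?thesis by (simp add: algebra_simps eq_neg_iff_add_eq_0)
qed

text \<open>A matrix entry is a vertex with four boolean edges: \<open>h\<close> and \<open>h'\<close> are the
partial row sums to its left and right, \<open>u\<close> and \<open>v\<close> the partial column sums
above and below it. The entry is \<open>h' - h = v - u\<close>. The two kinds of zero entries
are weighted according to whether the two partial sums agree; an entry \<open>1\<close> is weighted by
the row parameter \<open>x\<close> and an entry \<open>-1\<close> by the column parameter \<open>y\<close>. Putting the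
asymmetry between \<open>x\<close> and \<open>y\<close> there, instead of a square root of \<open>x * y\<close> in both places,
keeps all weights linear and makes the degree in a column parameter as small as possible.
For \<open>x = y = 1\<close> every nonzero weight is \<open>1 - \<omega>\<close>.\<close>

definition vertex_weight :: "complex \<Rightarrow> complex \<Rightarrow> bool \<Rightarrow> bool \<Rightarrow> bool \<Rightarrow> bool \<Rightarrow> complex" where
  "vertex_weight x y h u h' v =
     (if h' = h \<and> v = u then (if h = u then y - \<omega> * x else x - \<omega> * y)
      else if \<not> h \<and> \<not> u \<and> h' \<and> v then (1 - \<omega>) * x
      else if h \<and> u \<and> \<not> h' \<and> \<not> v then (1 - \<omega>) * y
      else 0)"

definition bool_lists :: "nat \<Rightarrow> bool list set" where
  "bool_lists n = {v. length v = n}"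

lemma finite_bool_lists [simp]: "finite (bool_lists n)"
  unfolding bool_lists_def using finite_lists_length_eq[of "UNIV :: bool set" n] by simp

lemma bool_lists_0 [simp]: "bool_lists 0 = {[]}"
  by (auto simp: bool_lists_def)

lemma sum_bool_lists_Suc:
  "(\<Sum>v\<in>bool_lists (Suc n). F v) =
     (\<Sum>v\<in>bool_lists n. F (False # v)) + (\<Sum>v\<in>bool_lists n. F (True # v))"
proof -
  have eq: "bool_lists (Suc n) = Cons False ` bool_lists n \<union> Cons True ` bool_lists n"
    by (auto simp: bool_lists_def length_Suc_conv image_iff)
  show ?thesis
    unfolding eq
    by (subst sum.union_disjoint) (auto simp: sum.reindex)
qed

text \<open>The row is read from left to right with current partial row sum \<open>h\<close>; the final partial
sum has to be 1.\<close>

fun row_weight :: "complex \<Rightarrow> complex list \<Rightarrow> bool list \<Rightarrow> bool list \<Rightarrow> bool \<Rightarrow> complex" where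
  "row_weight x (y # ys) (u # us) (v # vs) h =
     (\<Sum>h'\<in>UNIV. vertex_weight x y h u h' v * row_weight x ys us vs h')"
| "row_weight x _ _ _ h = of_bool h"

definition two_row_weight ::
  "complex \<Rightarrow> complex \<Rightarrow> complex list \<Rightarrow> bool list \<Rightarrow> bool list \<Rightarrow> bool \<Rightarrow> bool \<Rightarrow> complex" where
  "two_row_weight x x' ys us ws h g =
     (\<Sum>v\<in>bool_lists (length ys). row_weight x ys us v h * row_weight x' ys v ws g)"

definition two_vertex_weight ::
  "complex \<Rightarrow> complex \<Rightarrow> complex \<Rightarrow> bool \<Rightarrow> bool \<Rightarrow> bool \<Rightarrow> bool \<Rightarrow> bool \<Rightarrow> bool \<Rightarrow> complex" where
  "two_vertex_weight x x' y h g u h' g' w =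
     (\<Sum>v\<in>UNIV. vertex_weight x y h u h' v * vertex_weight x' y g v g' w)"

lemma two_row_weight_Nil: "two_row_weight x x' [] us ws h g = of_bool h * of_bool g"
  by (simp add: two_row_weight_def)

lemma two_row_weight_Cons:
  "two_row_weight x x' (y # ys) (u # us) (w # ws) h g =
     (\<Sum>h'\<in>UNIV. \<Sum>g'\<in>UNIV. two_vertex_weight x x' y h g u h' g' w * two_row_weight x x' ys us ws h' g')"
  unfolding two_row_weight_def two_vertex_weight_def
  by (simp add: sum_bool_lists_Suc UNIV_bool sum_distrib_left sum_distrib_right
        sum.distrib ring_distribs mult_ac)

text \<open>The intertwiner of the horizontal edges of two adjacent rows with parameters \<open>x\<close> (upper)
and \<open>x'\<close> (lower). It acts by the scalar \<open>x' - \<omega> * x\<close> on the boundary states in which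
both edges agree, and those are the states at both ends of a pair of rows.\<close>

definition R_weight :: "complex \<Rightarrow> complex \<Rightarrow> bool \<Rightarrow> bool \<Rightarrow> bool \<Rightarrow> bool \<Rightarrow> complex" where
  "R_weight x x' h g h' g' =
     (if h = g \<and> h' = h \<and> g' = g then x' - \<omega> * x
      else if \<not> h \<and> g \<and> \<not> h' \<and> g' then (1 - \<omega>) * x'
      else if h \<and> \<not> g \<and> h' \<and> \<not> g' then (1 - \<omega>) * x
      else if h \<noteq> g \<and> h' = g \<and> g' = h then \<omega> ^ 2 * (x - x')
      else 0)"

text \<open>A finite identity between polynomials modulo \<open>\<omega> ^ 2 = - 1 - \<omega>\<close>, one for each of the
64 choices of the boundary edges.\<close>

lemma yang_baxter:
  "(\<Sum>h1\<in>UNIV. \<Sum>g1\<in>UNIV. R_weight x x' h g h1 g1 * two_vertex_weight x x' y h1 g1 u h' g' w) =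
   (\<Sum>h1\<in>UNIV. \<Sum>g1\<in>UNIV. two_vertex_weight x' x y h g u h1 g1 w * R_weight x x' h1 g1 h' g')"
proof -
  have o2: "\<omega> * \<omega> = - 1 - \<omega>"
    using omega_squared by (simp add: power2_eq_square)
  have o2': "\<omega> * (\<omega> * a) = - a - \<omega> * a" for a
    unfolding mult.assoc [symmetric] o2 by (simp add: algebra_simps)
  show ?thesis
    apply (cases h; cases g; cases u; cases h'; cases g'; cases w;
        simp add: R_weight_def two_vertex_weight_def vertex_weight_def UNIV_bool omega_squared)
    apply (simp_all add: algebra_simps power2_eq_square o2 o2')
    done
qed

lemma double_sum_assoc:
  fixes R :: "'a \<Rightarrow> 'b \<Rightarrow> 'e :: comm_semiring_0"
  shows "(\<Sum>a\<in>A. \<Sum>b\<in>B. R a b * (\<Sum>c\<in>C. \<Sum>d\<in>D. M a b c d * T c d)) =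
         (\<Sum>c\<in>C. \<Sum>d\<in>D. (\<Sum>a\<in>A. \<Sum>b\<in>B. R a b * M a b c d) * T c d)"
proof -
  have "(\<Sum>a\<in>A. \<Sum>b\<in>B. R a b * (\<Sum>c\<in>C. \<Sum>d\<in>D. M a b c d * T c d)) =
        (\<Sum>(a, b)\<in>A \<times> B. \<Sum>(c, d)\<in>C \<times> D. R a b * M a b c d * T c d)"
    by (simp add: sum.cartesian_product [symmetric] sum_distrib_left mult.assoc)
  also have "\<dots> = (\<Sum>(c, d)\<in>C \<times> D. \<Sum>(a, b)\<in>A \<times> B. R a b * M a b c d * T c d)"
    unfolding case_prod_unfold by (rule sum.swap)
  also have "\<dots> = (\<Sum>c\<in>C. \<Sum>d\<in>D. (\<Sum>a\<in>A. \<Sum>b\<in>B. R a b * M a b c d) * T c d)"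
    by (simp add: sum.cartesian_product [symmetric] sum_distrib_right)
  finally show ?thesis .
qed

text \<open>The intertwiner is pushed through the two rows column by column with the Yang--Baxter
equation; at the right end both partial sums are 1 and it becomes a scalar.\<close>

lemma two_row_weight_exchange:
  assumes "length us = length ys" "length ws = length ys"
  shows "(\<Sum>h1\<in>UNIV. \<Sum>g1\<in>UNIV. R_weight x x' h g h1 g1 * two_row_weight x x' ys us ws h1 g1) =
           (x' - \<omega> * x) * two_row_weight x' x ys us ws h g"
  using assms
proof (induction ys us arbitrary: ws h g rule: list_induct2')
  case 1
  then show ?case
    by (auto simp: two_row_weight_Nil R_weight_def UNIV_bool)
next
  case (4 y ys u us)
  then obtain w ws' where ws: "ws = w # ws'" "length ws' = length ys"
    by (cases ws) auto
  have IH: "(\<Sum>h1\<in>UNIV. \<Sum>g1\<in>UNIV. R_weight x x' h g h1 g1 * two_row_weight x x' ys us ws' h1 g1) =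
              (x' - \<omega> * x) * two_row_weight x' x ys us ws' h g" for h g
    using 4 ws by auto
  let ?T = "two_row_weight x x' ys us ws'" and ?R = "R_weight x x'"
  have "(\<Sum>h1\<in>UNIV. \<Sum>g1\<in>UNIV. ?R h g h1 g1 * two_row_weight x x' (y # ys) (u # us) ws h1 g1) =
        (\<Sum>h2\<in>UNIV. \<Sum>g2\<in>UNIV. (\<Sum>h1\<in>UNIV. \<Sum>g1\<in>UNIV. ?R h g h1 g1 *
           two_vertex_weight x x' y h1 g1 u h2 g2 w) * ?T h2 g2)"
    unfolding ws two_row_weight_Cons by (rule double_sum_assoc)
  also have "\<dots> = (\<Sum>h2\<in>UNIV. \<Sum>g2\<in>UNIV. (\<Sum>h1\<in>UNIV. \<Sum>g1\<in>UNIV.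
           two_vertex_weight x' x y h g u h1 g1 w * ?R h1 g1 h2 g2) * ?T h2 g2)"
    by (simp only: yang_baxter)
  also have "\<dots> = (\<Sum>h1\<in>UNIV. \<Sum>g1\<in>UNIV. two_vertex_weight x' x y h g u h1 g1 w *
           (\<Sum>h2\<in>UNIV. \<Sum>g2\<in>UNIV. ?R h1 g1 h2 g2 * ?T h2 g2))"
    by (rule double_sum_assoc [symmetric])
  also have "\<dots> = (x' - \<omega> * x) * two_row_weight x' x (y # ys) (u # us) ws h g"
    unfolding IH ws two_row_weight_Cons sum_distrib_left
    by (intro sum.cong refl mult.left_commute)
  finally show ?case .
qed auto

lemma two_row_weight_commute:
  assumes "length us = length ys" "length ws = length ys" "x' \<noteq> \<omega> * x"
  shows "two_row_weight x x' ys us ws False False = two_row_weight x' x ys us ws False False"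
proof -
  have "(x' - \<omega> * x) * two_row_weight x x' ys us ws False False =
        (x' - \<omega> * x) * two_row_weight x' x ys us ws False False"
    using two_row_weight_exchange[OF assms(1,2), of x x' False False]
    by (simp add: R_weight_def UNIV_bool)
  then show ?thesis using assms(3) by simp
qed

text \<open>The sum of the weights of all fillings of a grid whose rows have parameters \<open>xs\<close> and whose
columns have parameters \<open>ys\<close>, starting from the vertical edges \<open>u\<close> and ending with all
partial column sums equal to 1.\<close>

fun partition_fn :: "complex list \<Rightarrow> complex list \<Rightarrow> bool list \<Rightarrow> complex" where
  "partition_fn [] ys u = of_bool (list_all id u)"
| "partition_fn (x # xs) ys u =
     (\<Sum>v\<in>bool_lists (length ys). row_weight x ys u v False * partition_fn xs ys v)"

lemma partition_fn_swap:
  assumes "length u = length ys" "x' \<noteq> \<omega> * x"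
  shows "partition_fn (x # x' # xs) ys u = partition_fn (x' # x # xs) ys u"
proof -
  have *: "partition_fn (x # x' # xs) ys u =
    (\<Sum>w\<in>bool_lists (length ys). two_row_weight x x' ys u w False False * partition_fn xs ys w)" for x x'
    unfolding partition_fn.simps two_row_weight_def sum_distrib_left sum_distrib_right
    by (subst sum.swap) (simp add: mult.assoc)
  show ?thesis unfolding *
    using assms two_row_weight_commute[of u ys _ x' x]
    by (intro sum.cong refl) (simp add: bool_lists_def)
qed

text \<open>The partition function is symmetric in the row parameters; only moving one parameter to the
front is needed, in order to bring any row next to the top boundary.\<close>

lemma partition_fn_move_to_front:
  assumes "length u = length ys" "\<forall>z\<in>set pre. x \<noteq> \<omega> * z"
  shows "partition_fn (pre @ x # post) ys u = partition_fn (x # pre @ post) ys u"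
  using assms
proof (induction pre arbitrary: u)
  case (Cons z pre)
  have "partition_fn ((z # pre) @ x # post) ys u = partition_fn (z # x # pre @ post) ys u"
    using Cons by (simp add: bool_lists_def)
  also have "\<dots> = partition_fn (x # z # pre @ post) ys u"
    using Cons.prems by (intro partition_fn_swap) auto
  finally show ?case by simp
qed simp

section \<open>Alternants\<close>

text \<open>The numerator of a Schur polynomial in Jacobi's bialternant form, for an increasing sequence
\<open>e\<close> of exponents.\<close>

definition alternant :: "(nat \<Rightarrow> nat) \<Rightarrow> 'a :: idom list \<Rightarrow> 'a" where
  "alternant e ts = det (mat (length ts) (length ts) (\<lambda>(i, j). ts ! i ^ e j))"

lemma alternant_Nil [simp]: "alternant e [] = 1"
  by (simp add: alternant_def)

lemma alternant_repeated:
  assumes "t \<in> set ts"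
  shows "alternant e (t # ts) = 0"
proof -
  from assms obtain k where k: "k < length ts" "ts ! k = t"
    by (auto simp: in_set_conv_nth)
  show ?thesis
    unfolding alternant_def
    by (rule det_identical_rows[where i = 0 and j = "Suc k" and n = "Suc (length ts)"])
       (use k in \<open>auto intro!: eq_vecI\<close>)
qed

lemma alternant_swap:
  "alternant e (pre @ a # b # post) = - alternant e (pre @ b # a # post)"
proof -
  let ?n = "length pre + Suc (Suc (length post))"
  let ?A = "mat ?n ?n (\<lambda>(i, j). (pre @ b # a # post) ! i ^ e j)"
  have "mat ?n ?n (\<lambda>(i, j). (pre @ a # b # post) ! i ^ e j) =
        swaprows (length pre) (Suc (length pre)) ?A"
    by (rule eq_matI)
       (auto simp: mat_swaprows_def nth_append nth_Cons split: nat.splits)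
  then show ?thesis
    unfolding alternant_def
    using det_swaprows[of "length pre" ?n "Suc (length pre)" ?A] by simp
qed

lemma alternant_move_to_front:
  "alternant e (pre @ x # post) = (-1) ^ length pre * alternant e (x # pre @ post)"
proof (induction pre arbitrary: post rule: rev_induct)
  case (snoc z pre)
  have "alternant e ((pre @ [z]) @ x # post) = - alternant e (pre @ x # z # post)"
    using alternant_swap[of e pre z x post] by simp
  then show ?case using snoc[of "z # post"] by simp
qed simp

text \<open>Subtracting \<open>c\<close> times the column with exponent \<open>e j\<close> from the one with exponent
\<open>e j + d\<close>, for all \<open>j\<close> at once, multiplies the matrix by a unitriangular
matrix. Afterwards the rows of \<open>rs\<close> vanish outside the first columns, and in the row of
any other \<open>t\<close> the factor \<open>t ^ d - c\<close> can be taken out. The case \<open>d = 1\<close> gives the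
Vandermonde product, the case \<open>d = 3\<close> the recursion for the Schur polynomial
below.\<close>

lemma alternant_shift:
  fixes rs ts :: "'a :: idom list"
  assumes "rs \<noteq> []"
    and e: "\<And>j. e (j + length rs) = e j + d"
    and rs: "\<And>r. r \<in> set rs \<Longrightarrow> r ^ d = c"
  shows "alternant e (rs @ ts) = alternant e rs * (\<Prod>t\<leftarrow>ts. t ^ d - c) * alternant e ts"
proof -
  define s where "s = length rs"
  have s: "s > 0"
    using assms(1) by (simp add: s_def)
  define m where "m = length ts"
  define A where "A = mat (s + m) (s + m) (\<lambda>(i, j). (rs @ ts) ! i ^ e j)"
  \<comment> \<open>The column operations, and the block triangular shape that they produce.\<close>
  define U where "U = mat (s + m) (s + m)
     (\<lambda>(k, j). if k = j then 1 else if k + s = j then - c else (0 :: 'a))"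
  define A1 where "A1 = mat s s (\<lambda>(i, j). rs ! i ^ e j)"
  define A3 where "A3 = mat m s (\<lambda>(i, j). ts ! i ^ e j)"
  define A4 where "A4 = mat m m (\<lambda>(i, j). ts ! i ^ e j)"
  define D where "D = mat m m (\<lambda>(i, j). if i = j then ts ! i ^ d - c else 0)"
  have detU: "det U = 1"
  proof -
    have "det U = prod_list (diag_mat U)"
      by (rule det_upper_triangular[where n = "s + m"])
         (use s in \<open>auto simp: U_def upper_triangular_def\<close>)
    also have "diag_mat U = replicate (s + m) 1"
      by (intro nth_equalityI) (auto simp: diag_mat_def U_def)
    finally show ?thesis by simp
  qed
  have detD: "det D = (\<Prod>t\<leftarrow>ts. t ^ d - c)"
  proof -
    have "det D = prod_list (diag_mat D)"
      by (rule det_upper_triangular[where n = m]) (auto simp: D_def upper_triangular_def)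
    also have "diag_mat D = map (\<lambda>t. t ^ d - c) ts"
      by (intro nth_equalityI) (auto simp: diag_mat_def D_def m_def)
    finally show ?thesis by simp
  qed
  have "A * U = four_block_mat A1 (0\<^sub>m s m) A3 (D * A4)"
  proof (rule eq_matI)
    fix i j
    assume "i < dim_row (four_block_mat A1 (0\<^sub>m s m) A3 (D * A4))"
      and "j < dim_col (four_block_mat A1 (0\<^sub>m s m) A3 (D * A4))"
    then have i: "i < s + m" and j: "j < s + m"
      by (auto simp: A1_def D_def A4_def)
    let ?t = "(rs @ ts) ! i"
    have "(A * U) $$ (i, j) = (\<Sum>k<s + m. ?t ^ e k * U $$ (k, j))"
      using i j by (auto simp: A_def U_def scalar_prod_def lessThan_atLeast0 intro!: sum.cong)
    also have "\<dots> = (\<Sum>k<s + m. (if k = j then ?t ^ e k else 0)) -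
        (\<Sum>k<s + m. (if k + s = j then c * ?t ^ e k else 0))"
      unfolding sum_subtractf [symmetric]
      by (rule sum.cong) (use j s in \<open>auto simp: U_def\<close>)
    also have "(\<Sum>k<s + m. (if k + s = j then c * ?t ^ e k else 0)) =
        (if s \<le> j then c * ?t ^ e (j - s) else 0)"
    proof (cases "s \<le> j")
      case True
      then have "(\<Sum>k<s + m. (if k + s = j then c * ?t ^ e k else 0)) =
          (\<Sum>k<s + m. (if k = j - s then c * ?t ^ e k else 0))"
        by (intro sum.cong) auto
      then show ?thesis using True j by simp
    qed (auto intro!: sum.neutral)
    also have "(\<Sum>k<s + m. (if k = j then ?t ^ e k else 0)) = ?t ^ e j"
      using j by simp
    finally have AU: "(A * U) $$ (i, j) =
        ?t ^ e j - (if s \<le> j then c * ?t ^ e (j - s) else 0)" .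
    have DA: "(D * A4) $$ (a, b) = (ts ! a ^ d - c) * ts ! a ^ e b" if "a < m" "b < m" for a b
    proof -
      have "(D * A4) $$ (a, b) = (\<Sum>k<m. (if a = k then ts ! a ^ d - c else 0) * ts ! k ^ e b)"
        using that by (simp add: D_def A4_def scalar_prod_def lessThan_atLeast0)
      also have "\<dots> = (\<Sum>k<m. if a = k then (ts ! a ^ d - c) * ts ! a ^ e b else 0)"
        by (rule sum.cong) auto
      finally show ?thesis using that by simp
    qed
    have ej: "?t ^ e j = ?t ^ e (j - s) * ?t ^ d" if "s \<le> j"
      using e[of "j - s"] that by (simp add: s_def power_add)
    show "(A * U) $$ (i, j) = four_block_mat A1 (0\<^sub>m s m) A3 (D * A4) $$ (i, j)"
    proof (cases "s \<le> j")
      case False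
      then show ?thesis
        using i j AU by (auto simp: A1_def A3_def D_def A4_def nth_append s_def)
    next
      case True
      show ?thesis
      proof (cases "i < s")
        case i': True
        have "?t ^ d = c"
          using i' by (intro rs) (simp add: nth_append s_def)
        then show ?thesis using i j i' AU True ej
          by (auto simp: A1_def D_def A4_def)
      next
        case False
        have "four_block_mat A1 (0\<^sub>m s m) A3 (D * A4) $$ (i, j) = (D * A4) $$ (i - s, j - s)"
          using i j False True
          by (subst index_mat_four_block) (auto simp: A1_def D_def A4_def)
        also have "\<dots> = (?t ^ d - c) * ?t ^ e (j - s)"
          using i j False True by (subst DA) (auto simp: nth_append s_def)
        also have "\<dots> = (A * U) $$ (i, j)"
          using True unfolding AU by (simp add: ej left_diff_distrib mult.commute)
        finally show ?thesis by (rule sym)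
      qed
    qed
  qed (auto simp: A_def U_def A1_def D_def A4_def)
  moreover have "det (four_block_mat A1 (0\<^sub>m s m) A3 (D * A4)) = det A1 * det (D * A4)"
  proof (rule det_four_block_mat_upper_right_zero[OF _ refl])
    show "D * A4 \<in> carrier_mat m m"
      by (rule mult_carrier_mat) (auto simp: D_def A4_def)
  qed (auto simp: A1_def A3_def)
  moreover have "det (A * U) = det A * det U"
    by (rule det_mult[where n = "s + m"]) (auto simp: A_def U_def)
  moreover have "det (D * A4) = det D * det A4"
    by (rule det_mult[where n = m]) (auto simp: D_def A4_def)
  ultimately show ?thesis
    using detU detD by (simp add: alternant_def A_def A1_def A4_def s_def m_def mult.assoc)
qed

fun vandermonde :: "'a :: idom list \<Rightarrow> 'a" where
  "vandermonde [] = 1"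
| "vandermonde (t # ts) = (\<Prod>s\<leftarrow>ts. s - t) * vandermonde ts"

lemma alternant_id: "alternant (\<lambda>j. j) ts = vandermonde ts"
proof (induction ts)
  case (Cons t ts)
  have "alternant (\<lambda>j. j) [t] = 1"
    by (simp add: alternant_def det_single)
  then show ?case
    using alternant_shift[of "[t]" "\<lambda>j. j" 1 t ts] Cons by simp
qed simp

lemma vandermonde_repeated: "t \<in> set ts \<Longrightarrow> vandermonde (t # ts) = 0"
  by (auto simp: prod_list_zero_iff)

text \<open>On a geometric progression an alternant is, after transposition, a Vandermonde determinant
itself: this is the principal specialization.\<close>

lemma alternant_geometric:
  "alternant e (map (\<lambda>i. q ^ i) [0..<n]) = vandermonde (map (\<lambda>j. q ^ e j) [0..<n])"
proof -
  have "alternant e (map (\<lambda>i. q ^ i) [0..<n]) = det (mat n n (\<lambda>(i, j). q ^ (i * e j)))"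
    unfolding alternant_def
    by (intro arg_cong[of _ _ det] eq_matI) (auto simp: power_mult)
  also have "\<dots> = det (transpose_mat (mat n n (\<lambda>(i, j). q ^ (i * e j))))"
    by (rule det_transpose [symmetric, where n = n]) simp
  also have "\<dots> = alternant (\<lambda>j. j) (map (\<lambda>j. q ^ e j) [0..<n])"
    unfolding alternant_def
    by (intro arg_cong[of _ _ det] eq_matI) (auto simp: power_mult [symmetric] mult.commute)
  finally show ?thesis by (simp add: alternant_id)
qed

section \<open>Polynomial functions of bounded degree\<close>

text \<open>Functions given by a polynomial of degree less than \<open>n\<close>. Counting coefficients instead of
degrees makes \<open>n = 0\<close> the zero function, which occurs as the base case of the degree bound for
the partition function.\<close>

definition poly_fun :: "nat \<Rightarrow> ('a :: comm_ring_1 \<Rightarrow> 'a) \<Rightarrow> bool" where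
  "poly_fun n f \<longleftrightarrow> (\<exists>p. (\<forall>i\<ge>n. coeff p i = 0) \<and> f = poly p)"

lemma poly_fun_zero: "poly_fun n (\<lambda>_. 0)"
  unfolding poly_fun_def by (intro exI[of _ 0]) auto

lemma poly_fun_const: "poly_fun (Suc n) (\<lambda>_. c)"
  unfolding poly_fun_def by (intro exI[of _ "[:c:]"]) (auto simp: coeff_pCons split: nat.splits)

lemma poly_fun_mono: "poly_fun m f \<Longrightarrow> m \<le> n \<Longrightarrow> poly_fun n f"
  unfolding poly_fun_def by (metis order_trans)

lemma poly_fun_add: "poly_fun n f \<Longrightarrow> poly_fun n g \<Longrightarrow> poly_fun n (\<lambda>y. f y + g y)"
  unfolding poly_fun_def
  by (elim exE conjE, rule_tac x = "p + pa" in exI) (auto simp: fun_eq_iff)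

lemma poly_fun_cmult: "poly_fun n f \<Longrightarrow> poly_fun n (\<lambda>y. c * f y)"
  unfolding poly_fun_def
  by (elim exE conjE, rule_tac x = "smult c p" in exI) (auto simp: fun_eq_iff)

lemma poly_fun_diff: 
  assumes "poly_fun n f" "poly_fun n g" 
  shows "poly_fun n (\<lambda>y. f y - g y)"
  using poly_fun_add[OF assms(1) poly_fun_cmult[OF assms(2), of "-1"]] by simp

lemma poly_fun_sum: "(\<And>i. i \<in> I \<Longrightarrow> poly_fun n (f i)) \<Longrightarrow> poly_fun n (\<lambda>y. \<Sum>i\<in>I. f i y)"
  by (induction I rule: infinite_finite_induct) (auto intro: poly_fun_zero poly_fun_add)

lemma poly_fun_linear_mult:
  assumes "poly_fun n f"
  shows "poly_fun (Suc n) (\<lambda>y. (a * y + b) * f y)"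
proof -
  obtain p where p: "\<forall>i\<ge>n. coeff p i = 0" "f = poly p"
    using assms unfolding poly_fun_def by auto
  show ?thesis
    unfolding poly_fun_def
    by (rule exI[of _ "smult b p + smult a (pCons 0 p)"])
       (use p in \<open>auto simp: fun_eq_iff coeff_pCons algebra_simps split: nat.splits\<close>)
qed

lemma poly_fun_power: "poly_fun (Suc n) (\<lambda>y. y ^ n)"
  unfolding poly_fun_def
  by (intro exI[of _ "monom 1 n"]) (auto simp: fun_eq_iff poly_monom)

lemma poly_fun_eqI:
  fixes f g :: "'a :: idom \<Rightarrow> 'a"
  assumes "poly_fun n f" "poly_fun n g" "finite S" "n \<le> card S"
    and "\<And>y. y \<in> S \<Longrightarrow> f y = g y"
  shows "f = g"
proof -
  obtain p where p: "\<forall>i\<ge>n. coeff p i = 0" "(\<lambda>y. f y - g y) = poly p"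
    using poly_fun_diff[OF assms(1,2)] unfolding poly_fun_def by auto
  have "p = 0"
  proof (rule ccontr)
    assume p0: "p \<noteq> 0"
    then have "coeff p (degree p) \<noteq> 0" by simp
    then have "degree p < n" using p(1) by (meson not_le)
    moreover have "S \<subseteq> {y. poly p y = 0}"
      using assms(5) p(2) by (metis (mono_tags, lifting) diff_self mem_Collect_eq subsetI)
    then have "card S \<le> card {y. poly p y = 0}"
      by (intro card_mono poly_roots_finite p0)
    moreover have "card {y. poly p y = 0} \<le> degree p"
      by (rule card_poly_roots_bound[OF p0])
    ultimately show False using assms(4) by linarith
  qed
  then show ?thesis using p(2) by (auto simp: fun_eq_iff)
qed

lemma poly_fun_alternant:
  assumes "mono e"
  shows "poly_fun (Suc (e (length ts))) (\<lambda>y. alternant e (y # ts))"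
proof -
  let ?n = "Suc (length ts)"
  define A where "A y = mat ?n ?n (\<lambda>(i, j). (y # ts) ! i ^ e j)" for y
  have del: "mat_delete (A y) 0 j = mat_delete (A 0) 0 j" for y j
    by (intro eq_matI) (auto simp: A_def mat_delete_def)
  have "alternant e (y # ts) = (\<Sum>j<?n. cofactor (A 0) 0 j * y ^ e j)" for y
  proof -
    have "alternant e (y # ts) = det (A y)"
      by (simp add: alternant_def A_def)
    also have "\<dots> = (\<Sum>j<?n. A y $$ (0, j) * cofactor (A y) 0 j)"
      by (rule laplace_expansion_row) (auto simp: A_def)
    also have "\<dots> = (\<Sum>j<?n. cofactor (A 0) 0 j * y ^ e j)"
    proof (rule sum.cong)
      fix j assume "j \<in> {..<?n}"
      then have "A y $$ (0, j) = y ^ e j" by (simp add: A_def)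
      then show "A y $$ (0, j) * cofactor (A y) 0 j = cofactor (A 0) 0 j * y ^ e j"
        unfolding cofactor_def del[of y] by simp
    qed simp
    finally show ?thesis .
  qed
  moreover have "poly_fun (Suc (e (length ts))) (\<lambda>y. \<Sum>j<?n. cofactor (A 0) 0 j * y ^ e j)"
  proof (intro poly_fun_sum poly_fun_cmult)
    fix j assume "j \<in> {..<?n}"
    then have "e j \<le> e (length ts)" by (intro monoD[OF assms]) auto
    then show "poly_fun (Suc (e (length ts))) (\<lambda>y. y ^ e j)"
      by (intro poly_fun_mono[OF poly_fun_power]) auto
  qed
  ultimately show ?thesis by simp
qed

section \<open>The partition function as a Schur polynomial\<close>

lemma partition_fn_False_column:
  "partition_fn (x # xs) (y # ys) (False # us) =
     (\<Sum>v\<in>bool_lists (length ys).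
        (y - \<omega> * x) * (row_weight x ys us v False * partition_fn xs (y # ys) (False # v)) +
        (1 - \<omega>) * x * row_weight x ys us v True * partition_fn xs (y # ys) (True # v))"
  by (simp add: sum_bool_lists_Suc vertex_weight_def UNIV_bool sum.distrib mult_ac)

lemma partition_fn_True_column:
  "partition_fn (x # xs) (y # ys) (True # us) =
     (\<Sum>v\<in>bool_lists (length ys).
        (x - \<omega> * y) * (row_weight x ys us v False * partition_fn xs (y # ys) (True # v)))"
  by (simp add: sum_bool_lists_Suc vertex_weight_def UNIV_bool mult_ac)

lemma partition_fn_strip_True:
  "partition_fn xs (y # ys) (True # us) = (\<Prod>x\<leftarrow>xs. x - \<omega> * y) * partition_fn xs ys us"
proof (induction xs arbitrary: us)
  case (Cons x xs)
  show ?case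
    unfolding partition_fn_True_column Cons.IH
    by (simp add: sum_distrib_left mult_ac)
qed simp

lemma poly_fun_linear_mult':
  assumes "poly_fun n f"
  shows "poly_fun (Suc n) (\<lambda>y. (y - a) * f y)" "poly_fun (Suc n) (\<lambda>y. (a - b * y) * f y)"
  using poly_fun_linear_mult[OF assms, of 1 "- a"] poly_fun_linear_mult[OF assms, of "- b" a]
  by simp_all

text \<open>The first column, read downwards, has left edges 0. It therefore contains exactly one entry
1, whose weight is free of \<open>y\<close>, while each zero contributes degree 1. If the column
starts with partial sum 1, all its entries are zeros.\<close>

lemma poly_fun_partition_fn:
  "poly_fun (length xs) (\<lambda>y. partition_fn xs (y # ys) (False # us))" (is ?A)
  "poly_fun (Suc (length xs)) (\<lambda>y. partition_fn xs (y # ys) (True # us))" (is ?B)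
proof -
  have "?A \<and> ?B"
  proof (induction xs arbitrary: us)
    case Nil
    then show ?case by (simp add: poly_fun_zero poly_fun_const)
  next
    case (Cons x xs)
    have "poly_fun (Suc (length xs)) (\<lambda>y. partition_fn (x # xs) (y # ys) (False # us))"
      unfolding partition_fn_False_column
      using Cons by (intro poly_fun_sum poly_fun_add poly_fun_linear_mult' poly_fun_cmult) auto
    moreover have "poly_fun (Suc (Suc (length xs))) (\<lambda>y. partition_fn (x # xs) (y # ys) (True # us))"
      unfolding partition_fn_True_column
      using Cons by (intro poly_fun_sum poly_fun_linear_mult' poly_fun_cmult) auto
    ultimately show ?case by simp
  qed
  then show ?A ?B by auto
qed

lemma row_weight_frozen:
  assumes "length v = length ys"
  shows "row_weight x ys (replicate (length ys) False) v True =
           (if v = replicate (length ys) False then \<Prod>y\<leftarrow>ys. x - \<omega> * y else 0)"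
  using assms
proof (induction ys arbitrary: v)
  case (Cons y ys)
  then show ?case
    by (cases v) (auto simp: vertex_weight_def UNIV_bool)
qed simp

text \<open>For \<open>y = \<omega> * x\<close> the weight of a zero in the top left corner vanishes. The corner is then
1, which forces the rest of the first row and of the first column to be zeros, and a smaller
grid remains.\<close>

lemma partition_fn_frozen_corner:
  assumes "y = \<omega> * x"
  shows "partition_fn (x # xs) (y # ys) (replicate (Suc (length ys)) False) =
           (1 - \<omega>) * x * (\<Prod>z\<leftarrow>ys. x - \<omega> * z) * (\<Prod>z\<leftarrow>xs. z - \<omega> ^ 2 * x) *
           partition_fn xs ys (replicate (length ys) False)"
proof -
  let ?F = "replicate (length ys) False"
  have "partition_fn (x # xs) (y # ys) (replicate (Suc (length ys)) False) =
        (\<Sum>v\<in>bool_lists (length ys).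
           (1 - \<omega>) * x * row_weight x ys ?F v True * partition_fn xs (y # ys) (True # v))"
    using assms by (simp only: replicate_Suc partition_fn_False_column) simp
  also have "\<dots> = (\<Sum>v\<in>bool_lists (length ys). if v = ?F then
        (1 - \<omega>) * x * (\<Prod>z\<leftarrow>ys. x - \<omega> * z) * partition_fn xs (y # ys) (True # v) else 0)"
    by (intro sum.cong refl) (simp add: row_weight_frozen bool_lists_def)
  also have "\<dots> = (1 - \<omega>) * x * (\<Prod>z\<leftarrow>ys. x - \<omega> * z) * partition_fn xs (y # ys) (True # ?F)"
    by (subst sum.delta) (auto simp: bool_lists_def [of "length ys", THEN eqset_imp_iff])
  finally show ?thesis
    using assms by (simp add: partition_fn_strip_True power2_eq_square mult_ac)
qed

text \<open>The exponents 0, 1, 3, 4, 6, 7, ..., which omit the residue class of 2 modulo 3. They belong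
to the partition \<open>(n - 1, n - 1, ..., 1, 1, 0, 0)\<close> shifted by the staircase.\<close>

definition schur_exponent :: "nat \<Rightarrow> nat" where
  "schur_exponent j = j + j div 2"

lemma mono_schur_exponent: "mono schur_exponent"
  unfolding schur_exponent_def by (intro monoI add_mono div_le_mono)

lemma omega_powers: "\<omega> * \<omega> = \<omega> ^ 2" "\<omega> * \<omega> ^ 2 = 1" "\<omega> ^ 2 * \<omega> = 1"
  using omega_cubed by (simp_all add: power2_eq_square power3_eq_cube mult.assoc)

lemma cube_difference: "t ^ 3 - x ^ 3 = (t - x) * (t - \<omega> * x) * (t - \<omega> ^ 2 * x)" for t x :: complex
proof -
  have "(t - \<omega> * x) * (t - \<omega> ^ 2 * x) = t * t - (\<omega> + \<omega> ^ 2) * (t * x) + (\<omega> * \<omega> ^ 2) * (x * x)"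
    by (simp add: algebra_simps)
  also have "\<dots> = t * t + t * x + x * x"
    by (simp only: omega_powers) (simp add: omega_squared)
  finally have "(t - x) * (t - \<omega> * x) * (t - \<omega> ^ 2 * x) = (t - x) * (t * t + t * x + x * x)"
    by (simp only: mult.assoc)
  then show ?thesis
    by (simp add: power3_eq_cube algebra_simps)
qed

text \<open>Both \<open>x\<close> and \<open>\<omega> * x\<close> have cube \<open>x ^ 3\<close>, and the sequence of exponents is invariant under
adding 3, so two variables can be removed at once.\<close>

lemma asm_alternant_reduce:
  "alternant schur_exponent (x # \<omega> * x # ts) =
     (\<omega> * x - x) * (\<Prod>t\<leftarrow>ts. t ^ 3 - x ^ 3) * alternant schur_exponent ts"
proof -
  have "alternant schur_exponent [x, \<omega> * x] = alternant (\<lambda>j. j) [x, \<omega> * x]"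
    unfolding alternant_def
    by (intro arg_cong[of _ _ det] eq_matI) (auto simp: schur_exponent_def)
  then have "alternant schur_exponent [x, \<omega> * x] = \<omega> * x - x"
    by (simp add: alternant_id)
  moreover have "alternant schur_exponent ([x, \<omega> * x] @ ts) =
      alternant schur_exponent [x, \<omega> * x] * (\<Prod>t\<leftarrow>ts. t ^ 3 - x ^ 3) * alternant schur_exponent ts"
  proof (rule alternant_shift)
    show "schur_exponent (j + length [x, \<omega> * x]) = schur_exponent j + 3" for j
      by (simp add: schur_exponent_def)
    show "r ^ 3 = x ^ 3" if "r \<in> set [x, \<omega> * x]" for r
      using that by (auto simp: power_mult_distrib omega_cubed)
  qed simp
  ultimately show ?thesis by simp
qed

lemma vandermonde_reduce:
  "vandermonde (x # \<omega> * x # ts) =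
     (\<omega> * x - x) * ((\<Prod>t\<leftarrow>ts. t - x) * (\<Prod>t\<leftarrow>ts. t - \<omega> * x)) * vandermonde ts"
  by (simp add: mult_ac)

lemma prod_list_mult: "(\<Prod>t\<leftarrow>ts. f t * g t) = (\<Prod>t\<leftarrow>ts. f t) * (\<Prod>t\<leftarrow>ts. g t)"
  for f g :: "'a \<Rightarrow> 'b :: comm_monoid_mult"
  by (induction ts) (simp_all add: mult_ac)

text \<open>The constants are chosen so that the recursions of the two sides of the evaluation at
\<open>y = \<omega> * x\<close> agree; a factor \<open>- \<omega>\<close> arises for each remaining column from
\<open>x - \<omega> * z = - \<omega> * (z - \<omega> ^ 2 * x)\<close>.\<close>

fun asm_const :: "nat \<Rightarrow> complex" where
  "asm_const 0 = 1"
| "asm_const (Suc n) = (1 - \<omega>) * (- \<omega>) ^ n * asm_const n"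

text \<open>Positive parameters are generic enough: none of them is \<open>\<omega>\<close> times another one, so all
interpolation points below are distinct and the scalar of the intertwiner is nonzero.\<close>

definition pos_complex :: "complex set" where
  "pos_complex = complex_of_real ` {0<..}"

lemma omega_times_pos:
  assumes "x \<in> pos_complex"
  shows "\<omega> * x \<notin> pos_complex"
proof
  assume "\<omega> * x \<in> pos_complex"
  with assms obtain a b where "a > 0" "\<omega> * complex_of_real a = complex_of_real b"
    unfolding pos_complex_def by auto
  then have "Im (\<omega> * complex_of_real a) = Im (complex_of_real b)"
    by simp
  then have "Im \<omega> * a = 0" by simp
  then show False using \<open>a > 0\<close> Im_omega by simp
qed

text \<open>Up to the factor \<open>asm_const n * prod_list xs\<close>, the partition function is the Schur
polynomial with shifted exponents \<open>schur_exponent\<close>. For \<open>n\<close> rows, both sides are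
polynomials of degree at most \<open>3 * n - 2\<close> in the first column parameter \<open>y\<close>. They
agree at \<open>3 * n - 1\<close> points: both vanish if \<open>y\<close> is one of the other \<open>2 * n - 1\<close> variables,
because of a repeated row, and for \<open>y = \<omega> * x\<close> with \<open>x\<close> one of the \<open>n\<close> row parameters
both reduce to the smaller grid without the row \<open>x\<close> and the first column.\<close>

theorem partition_fn_eq_alternant:
  assumes "length xs = length ys" "set (xs @ ys) \<subseteq> pos_complex" "distinct (xs @ ys)"
  shows "partition_fn xs ys (replicate (length ys) False) * vandermonde (xs @ ys) =
           asm_const (length ys) * prod_list xs * alternant schur_exponent (xs @ ys)"
  using assms
proof (induction ys arbitrary: xs)
  case Nil
  then show ?case by simp
next
  case (Cons y1 ys)
  let ?n = "length ys"
  let ?F = "replicate (Suc ?n) False"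
  let ?C = "asm_const (Suc ?n) * prod_list xs"
  define f where "f y = partition_fn xs (y # ys) ?F * vandermonde (y # xs @ ys)" for y
  define g where "g y = ?C * alternant schur_exponent (y # xs @ ys)" for y
  have len: "length xs = Suc ?n" using Cons.prems by simp
  have "f = g"
  proof (rule poly_fun_eqI)
    have lin: "poly_fun (k + length ts) (\<lambda>y. (\<Prod>s\<leftarrow>ts. s - y) * h y)" if "poly_fun k h" for k h ts
    proof (induction ts)
      case (Cons s ts)
      then show ?case
        using poly_fun_linear_mult[OF Cons, of "-1" s] by (simp add: mult.assoc)
    qed (use that in simp)
    have "poly_fun (Suc ?n + length (xs @ ys))
        (\<lambda>y. (\<Prod>s\<leftarrow>xs @ ys. s - y) * (vandermonde (xs @ ys) * partition_fn xs (y # ys) ?F))"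
      using poly_fun_partition_fn(1)[of xs ys "replicate ?n False"] len
      by (intro lin poly_fun_cmult) simp
    also have "(\<lambda>y. (\<Prod>s\<leftarrow>xs @ ys. s - y) * (vandermonde (xs @ ys) * partition_fn xs (y # ys) ?F)) = f"
      by (rule ext) (simp add: f_def mult_ac)
    also have "Suc ?n + length (xs @ ys) = 3 * ?n + 2"
      using len by simp
    finally show "poly_fun (3 * ?n + 2) f" .
    have "poly_fun (Suc (schur_exponent (length (xs @ ys)))) g"
      unfolding g_def by (intro poly_fun_cmult poly_fun_alternant mono_schur_exponent)
    moreover have "schur_exponent (length (xs @ ys)) = 3 * ?n + 1"
      using len by (simp add: schur_exponent_def)
    ultimately show "poly_fun (3 * ?n + 2) g" by simp
    have pos: "set xs \<subseteq> pos_complex" "set ys \<subseteq> pos_complex"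
      using Cons.prems by auto
    \<comment> \<open>The interpolation points: the other variables, and \<open>\<omega>\<close> times the row parameters.\<close>
    let ?S = "set (xs @ ys) \<union> (*) \<omega> ` set xs"
    show "finite ?S" by simp
    have "card ?S = card (set (xs @ ys)) + card ((*) \<omega> ` set xs)"
      using pos omega_times_pos by (intro card_Un_disjoint) auto
    also have "card ((*) \<omega> ` set xs) = card (set xs)"
      using Im_omega by (intro card_image) (auto simp: inj_on_def)
    finally show "3 * ?n + 2 \<le> card ?S"
      using Cons.prems by (simp add: distinct_card card_Un_disjoint)
    fix y assume "y \<in> ?S"
    then consider "y \<in> set (xs @ ys)" | x where "x \<in> set xs" "y = \<omega> * x"
      by auto
    then show "f y = g y"
    proof cases
      case 1
      then show ?thesis
        unfolding f_def g_def by (simp add: vandermonde_repeated alternant_repeated del: vandermonde.simps)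
    next
      case 2
      then obtain pre post where xs: "xs = pre @ x # post"
        by (meson split_list)
      define zs where "zs = pre @ post"
      define s :: complex where "s = (-1) ^ Suc (length pre)"
      \<comment> \<open>Reordering the variables changes both determinants by the same sign \<open>s\<close>.\<close>
      have move: "alternant e (y # xs @ ys) = s * alternant e (x # \<omega> * x # zs @ ys)" for e
        using alternant_move_to_front[of e "y # pre" x "post @ ys"] 2
        by (simp add: xs s_def zs_def)
      have IH: "partition_fn zs ys (replicate ?n False) * vandermonde (zs @ ys) =
                  asm_const ?n * prod_list zs * alternant schur_exponent (zs @ ys)"
        using Cons.prems by (intro Cons.IH) (auto simp: xs zs_def)
      have Z: "partition_fn xs (y # ys) ?F = partition_fn (x # zs) (y # ys) ?F"
        unfolding xs zs_def
      proof (rule partition_fn_move_to_front)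
        have "x \<in> pos_complex" "set pre \<subseteq> pos_complex"
          using Cons.prems by (auto simp: xs)
        then show "\<forall>z\<in>set pre. x \<noteq> \<omega> * z"
          using omega_times_pos by blast
      qed simp
      have ys: "(\<Prod>z\<leftarrow>ys. x - \<omega> * z) = (- \<omega>) ^ ?n * (\<Prod>z\<leftarrow>ys. z - \<omega> ^ 2 * x)"
      proof (induction ys)
        case (Cons z zs)
        have "x - \<omega> * z = - \<omega> * (z - \<omega> ^ 2 * x)"
          by (simp add: right_diff_distrib omega_powers flip: mult.assoc)
        then show ?case unfolding list.map prod_list.Cons Cons by simp
      qed simp
      let ?P = "\<lambda>c. \<Prod>t\<leftarrow>zs @ ys. t - c * x"
      have "f y = (1 - \<omega>) * x * (- \<omega>) ^ ?n * ?P (\<omega> ^ 2) * partition_fn zs ys (replicate ?n False) *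
                  (s * ((\<omega> * x - x) * (?P 1 * ?P \<omega>) * vandermonde (zs @ ys)))"
        unfolding f_def Z alternant_id [symmetric] move
        unfolding alternant_id vandermonde_reduce partition_fn_frozen_corner[OF 2(2)] ys
        by (simp add: mult_ac)
      also have "\<dots> = (1 - \<omega>) * x * (- \<omega>) ^ ?n * s * (\<omega> * x - x) * (?P 1 * ?P \<omega> * ?P (\<omega> ^ 2)) *
           (partition_fn zs ys (replicate ?n False) * vandermonde (zs @ ys))"
        by (simp only: mult_ac)
      also have "?P 1 * ?P \<omega> * ?P (\<omega> ^ 2) = (\<Prod>t\<leftarrow>zs @ ys. t ^ 3 - x ^ 3)"
        by (simp add: cube_difference prod_list_mult mult_ac)
      also have "(1 - \<omega>) * x * (- \<omega>) ^ ?n * s * (\<omega> * x - x) * (\<Prod>t\<leftarrow>zs @ ys. t ^ 3 - x ^ 3) *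
           (partition_fn zs ys (replicate ?n False) * vandermonde (zs @ ys)) = g y"
        unfolding g_def IH move asm_alternant_reduce
        by (simp add: xs zs_def mult_ac)
      finally show ?thesis .
    qed
  qed
  then have "f y1 = g y1" by simp
  moreover have "alternant e (xs @ y1 # ys) = (-1) ^ length xs * alternant e (y1 # xs @ ys)" for e
    by (rule alternant_move_to_front)
  ultimately show ?case
    unfolding f_def g_def alternant_id [symmetric] by (simp add: mult_ac)
qed

section \<open>Corner sums and the partition function at equal parameters\<close>

text \<open>Corner sum matrices of alternating sign matrices: \<open>f i j\<close> is the sum of the entries in the
first \<open>i\<close> rows and the first \<open>j\<close> columns. The conditions only relate neighbouring
positions, which allows cutting and gluing. The value 0 outside the square makes the
functions unique.\<close>

definition corner_sums :: "nat \<Rightarrow> (nat \<Rightarrow> nat \<Rightarrow> int) set" where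
  "corner_sums n = {f.
     (\<forall>i j. n < i \<or> n < j \<longrightarrow> f i j = 0) \<and>
     (\<forall>i\<le>n. f 0 i = 0 \<and> f i 0 = 0 \<and> f n i = int i \<and> f i n = int i) \<and>
     (\<forall>i<n. \<forall>j\<le>n. f (Suc i) j - f i j \<in> {0, 1} \<and> f j (Suc i) - f j i \<in> {0, 1})}"

text \<open>The support of \<open>row_weight\<close>: in each column the new partial row sum is determined by the old
one and the two vertical edges.\<close>

fun row_ok :: "bool list \<Rightarrow> bool list \<Rightarrow> bool \<Rightarrow> bool" where
  "row_ok (u # us) (v # vs) h =
     (if u = v then row_ok us vs h else h = u \<and> row_ok us vs (\<not> h))"
| "row_ok _ _ h = h"

lemma row_weight_ones:
  assumes "length us = n" "length vs = n"
  shows "row_weight 1 (replicate n 1) us vs h = (1 - \<omega>) ^ n * of_bool (row_ok us vs h)"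
  using assms
proof (induction n arbitrary: us vs h)
  case (Suc n)
  then obtain u us' v vs' where "us = u # us'" "vs = v # vs'" "length us' = n" "length vs' = n"
    by (metis length_Suc_conv)
  with Suc.IH show ?case
    by (cases h; cases u; cases v) (auto simp: UNIV_bool vertex_weight_def algebra_simps)
qed simp

fun step_chain :: "bool list \<Rightarrow> bool list list \<Rightarrow> bool" where
  "step_chain u [] = list_all id u"
| "step_chain u (v # vs) = (row_ok u v False \<and> step_chain v vs)"

definition step_chains :: "nat \<Rightarrow> nat \<Rightarrow> bool list \<Rightarrow> bool list list set" where
  "step_chains n m u = {vs. length vs = m \<and> (\<forall>v\<in>set vs. length v = n) \<and> step_chain u vs}"

lemma finite_step_chains: "finite (step_chains n m u)"
proof (rule finite_subset)
  show "step_chains n m u \<subseteq> {vs. set vs \<subseteq> bool_lists n \<and> length vs = m}"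
    by (auto simp: step_chains_def bool_lists_def)
qed (simp add: finite_lists_length_eq)

lemma step_chains_Suc:
  "step_chains n (Suc m) u =
     (\<Union>v\<in>{v \<in> bool_lists n. row_ok u v False}. Cons v ` step_chains n m v)"
  by (auto simp: step_chains_def bool_lists_def length_Suc_conv image_iff)

lemma partition_fn_ones:
  assumes "length u = n"
  shows "partition_fn (replicate m 1) (replicate n 1) u =
           (1 - \<omega>) ^ (m * n) * of_nat (card (step_chains n m u))"
  using assms
proof (induction m arbitrary: u)
  case 0
  have "step_chains n 0 u = (if list_all id u then {[]} else {})"
    by (auto simp: step_chains_def)
  then show ?case by simp
next
  case (Suc m)
  have "card (step_chains n (Suc m) u) =
        (\<Sum>v\<in>{v \<in> bool_lists n. row_ok u v False}. card (step_chains n m v))"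
    unfolding step_chains_Suc
    by (subst card_UN_disjoint) (auto simp: finite_step_chains card_image)
  also have "\<dots> = (\<Sum>v\<in>bool_lists n. if row_ok u v False then card (step_chains n m v) else 0)"
    by (simp add: sum.inter_filter)
  finally have card: "complex_of_nat (card (step_chains n (Suc m) u)) =
      (\<Sum>v\<in>bool_lists n. of_bool (row_ok u v False) * of_nat (card (step_chains n m v)))"
    by (simp only: of_nat_sum) (intro sum.cong refl, simp)
  have "partition_fn (replicate (Suc m) 1) (replicate n 1) u =
      (\<Sum>v\<in>bool_lists n. (1 - \<omega>) ^ (Suc m * n) *
         (of_bool (row_ok u v False) * of_nat (card (step_chains n m v))))"
    using Suc
    by (auto simp: row_weight_ones bool_lists_def power_add mult_ac intro!: sum.cong)
  then show ?case
    unfolding card by (simp only: sum_distrib_left)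
qed

definition prefix_sum :: "bool list \<Rightarrow> nat \<Rightarrow> int" where
  "prefix_sum v k = (\<Sum>j<k. of_bool (v ! j))"

lemma prefix_sum_0 [simp]: "prefix_sum v 0 = 0"
  by (simp add: prefix_sum_def)

lemma prefix_sum_Suc: "prefix_sum v (Suc k) = prefix_sum v k + of_bool (v ! k)"
  by (simp add: prefix_sum_def)

lemma prefix_sum_Cons: "prefix_sum (b # v) (Suc k) = of_bool b + prefix_sum v k"
  unfolding prefix_sum_def by (subst sum.lessThan_Suc_shift) simp

lemma row_ok_iff:
  assumes "length u = n" "length v = n"
  shows "row_ok u v h \<longleftrightarrow>
    (\<forall>k\<le>n. of_bool h + prefix_sum v k - prefix_sum u k \<in> {0, 1}) \<and>
    of_bool h + prefix_sum v n - prefix_sum u n = 1"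
  using assms
proof (induction n arbitrary: u v h)
  case 0
  then show ?case by (auto simp: prefix_sum_def)
next
  case (Suc n)
  then obtain a u' b v' where uv: "u = a # u'" "v = b # v'" and len: "length u' = n" "length v' = n"
    by (metis length_Suc_conv)
  have all_Suc: "(\<forall>k\<le>Suc n. P k) \<longleftrightarrow> P 0 \<and> (\<forall>k\<le>n. P (Suc k))" for P
    by (metis Suc_le_mono le0 not0_implies_Suc)
  show ?case
  proof (cases "a = b")
    case True
    have "of_bool h + (of_bool b + x) - (of_bool b + y) = of_bool h + x - y" for x y :: int
      by simp
    then show ?thesis
      unfolding uv all_Suc True prefix_sum_Cons by (simp only: row_ok.simps Suc.IH[OF len]) simp
  next
    case False
    show ?thesis
    proof (cases "h = a")
      case True
      with False show ?thesis
        unfolding uv all_Suc prefix_sum_Cons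
        by (cases h; cases b) (auto simp: Suc.IH[OF len])
    next
      case h: False
      then have "\<not> of_bool h + prefix_sum v 1 - prefix_sum u 1 \<in> {0, 1}"
        using False unfolding uv One_nat_def prefix_sum_Cons by (cases h; cases b) auto
      then show ?thesis using h False uv by auto
    qed
  qed
qed

lemma all_True_iff:
  assumes "length u = n"
  shows "list_all id u \<longleftrightarrow> (\<forall>j\<le>n. prefix_sum u j = int j)"
proof
  assume "list_all id u"
  then show "\<forall>j\<le>n. prefix_sum u j = int j"
    using assms by (auto simp: prefix_sum_def list_all_length)
next
  assume *: "\<forall>j\<le>n. prefix_sum u j = int j"
  have "u ! j" if "j < n" for j
  proof -
    have "prefix_sum u (Suc j) = int (Suc j)" "prefix_sum u j = int j"
      using * that by auto
    then have "of_bool (u ! j) = (1 :: int)"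
      unfolding prefix_sum_Suc by simp
    then show ?thesis by simp
  qed
  then show "list_all id u" using assms by (simp add: list_all_length)
qed

lemma step_chain_iff:
  "step_chain u vs \<longleftrightarrow>
     (\<forall>i<length vs. row_ok ((u # vs) ! i) ((u # vs) ! Suc i) False) \<and>
     list_all id ((u # vs) ! length vs)"
proof (induction vs arbitrary: u)
  case (Cons v vs)
  show ?case
    by (simp add: Cons All_less_Suc2 conj_assoc)
qed simp

lemma prefix_sum_diff:
  assumes "f 0 = 0" "\<And>j. j < n \<Longrightarrow> f (Suc j) - f j \<in> {0, 1}" "k \<le> n"
  shows "prefix_sum (map (\<lambda>j. f (Suc j) \<noteq> f j) [0..<n]) k = (f k :: int)"
  using assms(3)
proof (induction k)
  case (Suc k)
  then show ?case
    using assms(2)[of k] by (auto simp: prefix_sum_Suc)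
qed (simp add: assms)

text \<open>The partial column sums in row \<open>i\<close> of an alternating sign matrix are the differences of
neighbouring values of the \<open>i\<close>-th row of its corner sums, and the corner sums are recovered
as their prefix sums.\<close>

lemma corner_sums_step_chains:
  "\<exists>\<Phi>. bij_betw \<Phi> (corner_sums n) (step_chains n n (replicate n False))"
proof -
  let ?F = "replicate n False"
  \<comment> \<open>The chain starts with the all-zero edges above the first row, which \<open>\<Phi>\<close> omits.\<close>
  define \<Psi> where "\<Psi> vs = (\<lambda>i j. if i \<le> n \<and> j \<le> n then prefix_sum ((?F # vs) ! i) j else 0)" for vs
  define \<Phi> where "\<Phi> f = map (\<lambda>i. map (\<lambda>j. f i (Suc j) \<noteq> f i j) [0..<n]) [1..<Suc n]"
    for f :: "nat \<Rightarrow> nat \<Rightarrow> int"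
  have F: "prefix_sum ?F j = 0" if "j \<le> n" for j
    using that by (simp add: prefix_sum_def)
  have chain: "vs \<in> step_chains n n ?F \<longleftrightarrow>
      length vs = n \<and> (\<forall>v\<in>set vs. length v = n) \<and>
      (\<forall>i<n. (\<forall>k\<le>n. \<Psi> vs (Suc i) k - \<Psi> vs i k \<in> {0, 1}) \<and> \<Psi> vs (Suc i) n - \<Psi> vs i n = 1) \<and>
      (\<forall>j\<le>n. \<Psi> vs n j = int j)" for vs
  proof (cases "length vs = n \<and> (\<forall>v\<in>set vs. length v = n)")
    case True
    then have len: "length ((?F # vs) ! i) = n" if "i \<le> n" for i
      using that by (auto simp: nth_Cons split: nat.splits)
    show ?thesis
      using True len by (auto simp: step_chains_def step_chain_iff row_ok_iff all_True_iff \<Psi>_def)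
  qed (auto simp: step_chains_def)
  have "bij_betw \<Phi> (corner_sums n) (step_chains n n ?F)"
  proof (rule bij_betw_byWitness[where f' = \<Psi>])
    have \<Psi>\<Phi>: "\<Psi> (\<Phi> f) = f" if f: "f \<in> corner_sums n" for f
    proof (intro ext)
      fix i j
      show "\<Psi> (\<Phi> f) i j = f i j"
      proof (cases "i \<le> n \<and> j \<le> n")
        case True
        have "(?F # \<Phi> f) ! i = map (\<lambda>j. f i (Suc j) \<noteq> f i j) [0..<n]"
          using f True
          by (cases i) (auto simp: \<Phi>_def corner_sums_def nth_append intro!: nth_equalityI simp del: upt_Suc)
        moreover have "prefix_sum (map (\<lambda>j. f i (Suc j) \<noteq> f i j) [0..<n]) j = f i j"
          using f True by (intro prefix_sum_diff) (auto simp: corner_sums_def)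
        ultimately show ?thesis
          using True by (simp add: \<Psi>_def)
      next
        case False
        then show ?thesis using f by (auto simp: \<Psi>_def corner_sums_def)
      qed
    qed
    then show "\<forall>f\<in>corner_sums n. \<Psi> (\<Phi> f) = f" by blast
    show "\<Phi> ` corner_sums n \<subseteq> step_chains n n ?F"
    proof (intro subsetI, elim imageE, hypsubst)
      fix f assume f: "f \<in> corner_sums n"
      then have "f (Suc i) n - f i n = 1" if "i < n" for i
        using that by (auto simp: corner_sums_def)
      with f show "\<Phi> f \<in> step_chains n n ?F"
        unfolding chain \<Psi>\<Phi>[OF f] by (auto simp: \<Phi>_def corner_sums_def)
    qed
    show \<Psi>: "\<Psi> ` step_chains n n ?F \<subseteq> corner_sums n"
    proof (intro subsetI, elim imageE, hypsubst)
      fix vs assume vs: "vs \<in> step_chains n n ?F"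
      have n: "\<Psi> vs i n = int i" if "i \<le> n" for i
        using that
      proof (induction i)
        case 0
        then show ?case by (simp add: \<Psi>_def F)
      next
        case (Suc i)
        then have "i < n" by simp
        with vs have "\<Psi> vs (Suc i) n - \<Psi> vs i n = 1"
          unfolding chain by blast
        moreover have "\<Psi> vs i n = int i" using Suc by simp
        ultimately show ?case by linarith
      qed
      have "\<Psi> vs j (Suc i) - \<Psi> vs j i \<in> {0, 1}" if "i < n" "j \<le> n" for i j
        using that by (simp add: \<Psi>_def prefix_sum_Suc)
      moreover have "\<Psi> vs 0 i = 0" "\<Psi> vs i 0 = 0" for i
        by (auto simp: \<Psi>_def F)
      moreover have "\<Psi> vs i j = 0" if "n < i \<or> n < j" for i j
        using that by (auto simp: \<Psi>_def)
      ultimately show "\<Psi> vs \<in> corner_sums n"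
        using n vs unfolding corner_sums_def chain by auto
    qed
    show "\<forall>vs\<in>step_chains n n ?F. \<Phi> (\<Psi> vs) = vs"
    proof
      fix vs assume vs: "vs \<in> step_chains n n ?F"
      then have len: "length vs = n" "\<And>i. i < n \<Longrightarrow> length (vs ! i) = n"
        by (auto simp: chain)
      show "\<Phi> (\<Psi> vs) = vs"
        by (rule nth_equalityI; (rule nth_equalityI)?)
           (use len in \<open>auto simp: \<Phi>_def \<Psi>_def prefix_sum_Suc nth_append simp del: upt_Suc\<close>)
    qed
  qed
  then show ?thesis by blast
qed

lemma finite_corner_sums: "finite (corner_sums n)"
  using corner_sums_step_chains[of n] bij_betw_finite finite_step_chains by blast

lemma partition_fn_ones_corner_sums:
  "partition_fn (replicate n 1) (replicate n 1) (replicate n False) =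
     (1 - \<omega>) ^ (n * n) * of_nat (card (corner_sums n))"
  using corner_sums_step_chains[of n] bij_betw_same_card
  by (subst partition_fn_ones) fastforce+

section \<open>The homogeneous limit\<close>

lemma vandermonde_snoc: "vandermonde (ts @ [t]) = vandermonde ts * (\<Prod>s\<leftarrow>ts. t - s)"
  by (induction ts) (simp_all add: mult_ac)

lemma vandermonde_map: "vandermonde (map w [0..<m]) = (\<Prod>j<m. \<Prod>i<j. w j - w i)"
  by (induction m) (simp_all add: vandermonde_snoc atLeast0LessThan flip: prod.distinct_set_conv_list)

text \<open>The Vandermonde product of the powers \<open>q ^ a j\<close> with the factor \<open>q - 1\<close> removed from
each difference, so that \<open>q = 1\<close> can be inserted.\<close>

definition reduced_vandermonde :: "(nat \<Rightarrow> nat) \<Rightarrow> nat \<Rightarrow> complex \<Rightarrow> complex" where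
  "reduced_vandermonde a m q = (\<Prod>j<m. \<Prod>i<j. q ^ a i * (\<Sum>k<a j - a i. q ^ k))"

lemma vandermonde_powers:
  assumes "strict_mono a"
  shows "vandermonde (map (\<lambda>j. q ^ a j) [0..<m]) =
           (\<Prod>j<m. \<Prod>i<j. q - 1) * reduced_vandermonde a m q"
  unfolding vandermonde_map reduced_vandermonde_def prod.distrib [symmetric]
proof (intro prod.cong refl)
  fix i j :: nat assume "i \<in> {..<j}"
  then have "a i \<le> a j"
    using strict_mono_less_eq[OF assms] by simp
  then have "q ^ a j = q ^ a i * q ^ (a j - a i)"
    by (simp flip: power_add)
  moreover have "q ^ (a j - a i) - 1 = (q - 1) * (\<Sum>k<a j - a i. q ^ k)"
    by (rule power_diff_1_eq)
  ultimately show "q ^ a j - q ^ a i = (q - 1) * (q ^ a i * (\<Sum>k<a j - a i. q ^ k))"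
    by (metis (no_types, opaque_lifting) mult.left_commute mult.right_neutral right_diff_distrib)
qed

lemma strict_mono_schur_exponent: "strict_mono schur_exponent"
  by (rule strict_monoI) (simp add: schur_exponent_def add_less_le_mono div_le_mono)

lemma isCont_vertex_weight:
  assumes "isCont f q" "isCont g q"
  shows "isCont (\<lambda>z. vertex_weight (f z) (g z) h u h' v) q"
  unfolding vertex_weight_def using assms
  by (cases h; cases u; cases h'; cases v; simp; intro continuous_intros)

lemma isCont_row_weight:
  assumes "isCont f q" "\<forall>g\<in>set gs. isCont g q"
  shows "isCont (\<lambda>z. row_weight (f z) (map (\<lambda>g. g z) gs) u v h) q"
  using assms(2)
proof (induction gs arbitrary: u v h)
  case (Cons g gs)
  then show ?case
    using assms(1)
    by (cases u; cases v) (auto intro!: continuous_intros isCont_vertex_weight)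
qed simp

lemma isCont_partition_fn:
  assumes "\<forall>f\<in>set fs. isCont f q" "\<forall>g\<in>set gs. isCont g q"
  shows "isCont (\<lambda>z. partition_fn (map (\<lambda>f. f z) fs) (map (\<lambda>g. g z) gs) u) q"
  using assms(1)
proof (induction fs arbitrary: u)
  case (Cons f fs)
  then show ?case
    using assms(2) by (auto intro!: continuous_intros isCont_row_weight)
qed simp

definition difference_product :: "(nat \<Rightarrow> nat) \<Rightarrow> nat \<Rightarrow> nat" where
  "difference_product a m = (\<Prod>j<m. \<Prod>i<j. a j - a i)"

lemma reduced_vandermonde_1: "reduced_vandermonde a m 1 = of_nat (difference_product a m)"
  by (simp add: reduced_vandermonde_def difference_product_def)

text \<open>All parameters are powers of \<open>q > 1\<close>, for which both determinants factor, and \<open>q\<close> tends to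
1. Both sides are continuous in \<open>q\<close> once the common power of \<open>q - 1\<close> is cancelled.\<close>

theorem partition_fn_homogeneous:
  "partition_fn (replicate n 1) (replicate n 1) (replicate n False) * of_nat (difference_product (\<lambda>j. j) (2 * n)) =
     asm_const n * of_nat (difference_product schur_exponent (2 * n))"
proof -
  define Z where "Z q = partition_fn (map (\<lambda>i. q ^ i) [0..<n]) (map (\<lambda>i. q ^ i) [n..<2 * n]) (replicate n False)" for q
  define L where "L q = Z q * reduced_vandermonde (\<lambda>j. j) (2 * n) q" for q
  define R where "R q = asm_const n * prod_list (map (\<lambda>i. q ^ i) [0..<n]) * reduced_vandermonde schur_exponent (2 * n) q" for q
  have "L (complex_of_real q) = R (complex_of_real q)" if "q > 1" for q
  proof -
    let ?q = "complex_of_real q"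
    let ?xs = "map (\<lambda>i. ?q ^ i) [0..<n]" and ?ys = "map (\<lambda>i. ?q ^ i) [n..<2 * n]"
    have app: "?xs @ ?ys = map (\<lambda>i. ?q ^ i) [0..<2 * n]"
      by (metis le_add1 map_append mult_2 upt_add_eq_append zero_le)
    have inj: "inj_on (\<lambda>i. ?q ^ i) A" for A :: "nat set"
      using that by (intro inj_onI) (simp flip: of_real_power)
    have "?q ^ i \<in> pos_complex" for i
      using that by (simp add: pos_complex_def flip: of_real_power)
    then have "partition_fn ?xs ?ys (replicate (length ?ys) False) * vandermonde (?xs @ ?ys) =
          asm_const (length ?ys) * prod_list ?xs * alternant schur_exponent (?xs @ ?ys)"
      by (intro partition_fn_eq_alternant) (auto simp: app distinct_map inj simp del: map_append)
    then have "Z ?q * vandermonde (map (\<lambda>i. ?q ^ i) [0..<2 * n]) =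
        asm_const n * prod_list ?xs * vandermonde (map (\<lambda>j. ?q ^ schur_exponent j) [0..<2 * n])"
      unfolding app alternant_geometric by (simp add: Z_def)
    then have "(\<Prod>j<2 * n. \<Prod>i<j. ?q - 1) * L ?q = (\<Prod>j<2 * n. \<Prod>i<j. ?q - 1) * R ?q"
      unfolding vandermonde_powers[OF strict_mono_schur_exponent]
        vandermonde_powers[of "\<lambda>j. j", OF strict_mono_id[unfolded id_def]]
      by (simp only: L_def R_def mult_ac)
    moreover have "(\<Prod>j<2 * n. \<Prod>i<j. ?q - 1) \<noteq> 0"
      using that by auto
    ultimately show ?thesis
      using mult_left_cancel by blast
  qed
  then have ev: "\<forall>\<^sub>F q in at_right 1. L (complex_of_real q) = R (complex_of_real q)"
    by (auto simp: eventually_at_filter)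
  have "isCont (\<lambda>q. reduced_vandermonde a m q) 1" for a m
    unfolding reduced_vandermonde_def by (intro continuous_intros)
  moreover have "isCont Z 1"
    using isCont_partition_fn[of "map (\<lambda>i q. q ^ i) [0..<n]" 1 "map (\<lambda>i q. q ^ i) [n..<2 * n]" "replicate n False"]
    by (simp add: Z_def [abs_def] o_def)
  moreover have "isCont (\<lambda>q :: complex. prod_list (map (\<lambda>i. q ^ i) is)) 1" for "is"
    by (induction "is") (auto intro!: continuous_intros)
  ultimately have "isCont L 1" "isCont R 1"
    unfolding L_def R_def by (auto intro!: continuous_intros)
  moreover have "((\<lambda>q. complex_of_real q) \<longlongrightarrow> 1) (at_right 1)"
    by (auto intro!: tendsto_eq_intros)
  ultimately have "((\<lambda>q. L (complex_of_real q)) \<longlongrightarrow> L 1) (at_right 1)"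
      "((\<lambda>q. R (complex_of_real q)) \<longlongrightarrow> R 1) (at_right 1)"
    by (auto intro: isCont_tendsto_compose)
  then have "L 1 = R 1"
    using tendsto_cong[OF ev] tendsto_unique trivial_limit_at_right_real by metis
  then show ?thesis
    by (simp add: L_def R_def Z_def reduced_vandermonde_1 map_replicate_const)
qed

lemma difference_product_Suc:
  "difference_product a (Suc m) = difference_product a m * (\<Prod>i<m. a m - a i)"
  by (simp add: difference_product_def)

lemma difference_product_id_Suc:
  "difference_product (\<lambda>j. j) (Suc m) = difference_product (\<lambda>j. j) m * fact m"
proof -
  have "(\<Prod>i<m. m - i) = fact m"
    by (simp add: fact_prod_rev lessThan_atLeast0)
  then show ?thesis by (simp add: difference_product_Suc)
qed

lemma difference_product_exponent_Suc:
  "difference_product schur_exponent (2 * Suc n) =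
     difference_product schur_exponent (2 * n) * (3 ^ n * fact n * fact (3 * n + 1))"
proof -
  have exps: "schur_exponent (2 * i) = 3 * i" "schur_exponent (Suc (2 * i)) = 3 * i + 1" for i
    by (simp_all add: schur_exponent_def)
  have pairs: "(\<Prod>i<2 * n. g i) = (\<Prod>k<n. g (2 * k) * g (Suc (2 * k)))" for g :: "nat \<Rightarrow> nat" and n
    by (induction n) (simp_all add: mult_ac)
  \<comment> \<open>The differences of the two new exponents \<open>3 * n\<close>, \<open>3 * n + 1\<close> and the old ones
    \<open>3 * k\<close>, \<open>3 * k + 1\<close>; they depend on \<open>n - k\<close> only.\<close>
  define g where "g n k = (3 * n - 3 * k) * (3 * n - (3 * k + 1)) *
      ((3 * n + 1 - 3 * k) * (3 * n + 1 - (3 * k + 1)))" for n k :: nat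
  have prod: "(\<Prod>k<n. g n k) = 3 ^ n * fact n * (fact (3 * n + 1) :: nat)"
  proof (induction n)
    case (Suc n)
    have shift: "g (Suc n) (Suc k) = g n k" for k
      by (simp add: g_def)
    have "fact (Suc (Suc (Suc m))) = (m + 3) * (m + 2) * (m + 1) * (fact m :: nat)" for m
      by (simp add: algebra_simps)
    from this[of "3 * n + 1"]
    have fact: "fact (3 * Suc n + 1) = (3 * n + 4) * (3 * n + 3) * (3 * n + 2) * (fact (3 * n + 1) :: nat)"
      by (simp only: mult_Suc_right add_Suc_right add_Suc numeral_eq_Suc pred_numeral_simps BitM.simps One_nat_def add_0 add_0_right)
    have g0: "g (Suc n) 0 = 3 * Suc n * (3 * n + 2) * ((3 * n + 4) * (3 * n + 3))"
      by (simp add: g_def add.commute)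
    show ?case
      unfolding prod.lessThan_Suc_shift shift Suc.IH fact g0
      by (simp only: power_Suc fact_Suc of_nat_id mult_ac)
  qed simp
  show ?thesis
    unfolding mult_Suc_right add_2_eq_Suc difference_product_Suc prod.lessThan_Suc exps pairs
    using prod by (simp add: exps g_def prod.distrib mult_ac)
qed

lemma one_minus_omega_squared: "(1 - \<omega>) ^ 2 = - 3 * \<omega>"
  by (simp add: power2_diff omega_squared)

section \<open>The number of alternating sign matrices\<close>

text \<open>The recurrence equivalent to the product formula \<open>\<Prod>k<n. (3 k + 1)! / (n + k)!\<close> for
the number of alternating sign matrices.\<close>

theorem card_corner_sums_Suc:
  "card (corner_sums (Suc n)) * (fact (2 * n) * fact (2 * n + 1)) =
     fact n * fact (3 * n + 1) * card (corner_sums n)"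
proof -
  let ?X = "\<lambda>n. complex_of_nat (card (corner_sums n))"
  let ?P = "\<lambda>n. complex_of_nat (difference_product (\<lambda>j. j) (2 * n))"
  let ?E = "\<lambda>n. complex_of_nat (difference_product schur_exponent (2 * n))"
  have eval: "(1 - \<omega>) ^ (n * n) * ?X n * ?P n = asm_const n * ?E n" for n
    using partition_fn_homogeneous[of n] by (simp add: partition_fn_ones_corner_sums)
  have P: "?P (Suc n) = ?P n * (fact (2 * n) * fact (2 * n + 1))"
    unfolding mult_Suc_right add_2_eq_Suc difference_product_id_Suc
    by (simp only: of_nat_mult of_nat_fact Suc_eq_plus1 mult_ac)
  have E: "?E (Suc n) = ?E n * (3 ^ n * (fact n * fact (3 * n + 1)))"
    unfolding difference_product_exponent_Suc by (simp only: of_nat_mult of_nat_power of_nat_fact of_nat_numeral mult_ac)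
  have omega0: "\<omega> \<noteq> 0" "1 - \<omega> \<noteq> 0"
    using Im_omega by auto
  have P0: "?P n \<noteq> 0"
    by (simp add: difference_product_def)
  have "(1 - \<omega>) ^ (Suc n * Suc n) = (1 - \<omega>) ^ (n * n) * ((1 - \<omega>) * ((1 - \<omega>) ^ 2) ^ n)"
  proof -
    have "Suc n * Suc n = n * n + (1 + 2 * n)" by simp
    then show ?thesis by (simp only: power_add power_mult power_one_right)
  qed
  also have "\<dots> = (1 - \<omega>) ^ (n * n) * ((1 - \<omega>) * (- \<omega>) ^ n * 3 ^ n)"
  proof -
    have "- 3 * \<omega> = - \<omega> * 3" by simp
    then show ?thesis
      unfolding one_minus_omega_squared by (simp only: power_mult_distrib mult_ac)
  qed
  finally have pow: "(1 - \<omega>) ^ (Suc n * Suc n) = (1 - \<omega>) ^ (n * n) * ((1 - \<omega>) * (- \<omega>) ^ n * 3 ^ n)" .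
  \<comment> \<open>The nonzero factor common to the evaluations for \<open>n\<close> and \<open>Suc n\<close>.\<close>
  define K where "K = (1 - \<omega>) ^ (n * n) * ((1 - \<omega>) * (- \<omega>) ^ n * 3 ^ n) * ?P n"
  have "K * (?X (Suc n) * (fact (2 * n) * fact (2 * n + 1))) =
        (1 - \<omega>) ^ (Suc n * Suc n) * ?X (Suc n) * ?P (Suc n)"
    unfolding pow P K_def by (simp only: mult_ac)
  also have "\<dots> = (1 - \<omega>) * (- \<omega>) ^ n * (asm_const n * ?E n) * (3 ^ n * (fact n * fact (3 * n + 1)))"
    unfolding eval E asm_const.simps by (simp only: mult_ac)
  also have "\<dots> = K * (fact n * fact (3 * n + 1) * ?X n)"
    unfolding eval [symmetric] K_def by (simp only: mult_ac)
  finally have "?X (Suc n) * (fact (2 * n) * fact (2 * n + 1)) = fact n * fact (3 * n + 1) * ?X n"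
    using omega0 P0 by (subst (asm) mult_left_cancel) (simp_all add: K_def)
  then have "complex_of_nat (card (corner_sums (Suc n)) * (fact (2 * n) * fact (2 * n + 1))) =
      complex_of_nat (fact n * fact (3 * n + 1) * card (corner_sums n))"
    by (simp only: of_nat_mult of_nat_fact)
  then show ?thesis by (simp only: of_nat_eq_iff)
qed

lemma card_corner_sums_0: "card (corner_sums 0) = 1"
proof -
  have "corner_sums 0 = {\<lambda>_ _. 0}"
    by (auto simp: corner_sums_def fun_eq_iff) (metis neq0_conv)
  then show ?thesis by simp
qed

definition asm_ratio :: "nat \<Rightarrow> real" where
  "asm_ratio n = fact n * fact (3 * n + 1) / (fact (2 * n) * fact (2 * n + 1))"

lemma asm_ratio_Suc:
  "asm_ratio (Suc n) = asm_ratio n * (3 * (3 * real n + 4) * (3 * real n + 2) / (4 * (2 * real n + 1) * (2 * real n + 3)))"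
proof -
  have 3: "fact (3 * Suc n + 1) = (3 * real n + 4) * (3 * (n + 1)) * (3 * n + 2) * fact (3 * n + 1)"
    by (simp add: numeral_eq_Suc algebra_simps)
  have 2: "fact (2 * Suc n) = (2 * real n + 2) * (2 * n + 1) * fact (2 * n)"
    "fact (2 * Suc n + 1) = (2 * real n + 3) * (2 * n + 2) * fact (2 * n + 1)"
    by (simp_all add: algebra_simps)
  have 1: "fact (Suc n) = (real n + 1) * fact n" by simp
  show ?thesis
    unfolding asm_ratio_def 1 2 3
    by (simp del: fact_Suc add: divide_simps) (simp add: algebra_simps)?
qed

text \<open>The quotient of consecutive ratios tends to \<open>27 / 16\<close> from above, and it is
at most \<open>27 / 16 * ((n + 2) / (n + 1))\<close>. The latter factors telescope to \<open>n + 1\<close>.\<close>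

lemma asm_ratio_bounds:
  "(27 / 16) ^ n \<le> asm_ratio n" "asm_ratio n \<le> (27 / 16) ^ n * (real n + 1)"
proof (induction n)
  case 0
  show "(27 / 16) ^ 0 \<le> asm_ratio 0" "asm_ratio 0 \<le> (27 / 16) ^ 0 * (real 0 + 1)"
    by (simp_all add: asm_ratio_def)
next
  case (Suc n)
  let ?f = "3 * (3 * real n + 4) * (3 * real n + 2) / (4 * (2 * real n + 1) * (2 * real n + 3))"
  have "27 / 16 \<le> ?f"
    by (subst pos_le_divide_eq) (simp_all add: algebra_simps add_pos_nonneg)
  then have "(27 / 16) ^ n * (27 / 16) \<le> asm_ratio n * ?f"
    by (intro mult_mono Suc) (auto simp: asm_ratio_def)
  then show "(27 / 16) ^ Suc n \<le> asm_ratio (Suc n)"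
    by (simp only: asm_ratio_Suc power_Suc2)
  have "0 < 4 * (2 * real n + 1) * (2 * real n + 3)" "0 < 16 * (real n + 1)"
    by (intro mult_pos_pos; simp)+
  moreover have "3 * (3 * real n + 4) * (3 * real n + 2) * (16 * (real n + 1)) \<le>
      27 * (real n + 2) * (4 * (2 * real n + 1) * (2 * real n + 3))"
  proof -
    have "0 \<le> 264 + 804 * real n + 432 * (real n * real n)"
      by (intro add_nonneg_nonneg) auto
    then show ?thesis by (simp add: algebra_simps)
  qed
  ultimately have "?f \<le> 27 * (real n + 2) / (16 * (real n + 1))"
    by (simp only: pos_divide_le_eq pos_le_divide_eq times_divide_eq_left)
  then have "?f \<le> 27 / 16 * ((real n + 2) / (real n + 1))"
    by simp
  then have "asm_ratio n * ?f \<le> (27 / 16) ^ n * (real n + 1) * (27 / 16 * ((real n + 2) / (real n + 1)))"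
    by (intro mult_mono Suc) (auto simp: asm_ratio_def)
  also have "\<dots> = (27 / 16) ^ Suc n * (real (Suc n) + 1)"
  proof -
    have "p * (real n + 1) * (27 / 16 * ((real n + 2) / (real n + 1))) = 27 / 16 * p * (real n + 2)" for p
      by (simp add: field_simps)
    moreover have "real (Suc n) + 1 = real n + 2" by simp
    ultimately show ?thesis by (simp only: power_Suc)
  qed
  finally show "asm_ratio (Suc n) \<le> (27 / 16) ^ Suc n * (real (Suc n) + 1)"
    by (simp only: asm_ratio_Suc)
qed

theorem card_corner_sums_bounds:
  "(27 / 16) ^ (\<Sum>k<n. k) \<le> real (card (corner_sums n))"
  "real (card (corner_sums n)) \<le> (27 / 16) ^ (\<Sum>k<n. k) * fact n"
proof (induction n)
  case (Suc n)
  have "real (card (corner_sums (Suc n)) * (fact (2 * n) * fact (2 * n + 1))) =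
      real (fact n * fact (3 * n + 1) * card (corner_sums n))"
    by (simp only: card_corner_sums_Suc)
  then have rec: "real (card (corner_sums (Suc n))) = real (card (corner_sums n)) * asm_ratio n"
    unfolding of_nat_mult of_nat_fact by (simp add: asm_ratio_def eq_divide_eq mult_ac)
  show "(27 / 16) ^ (\<Sum>k<Suc n. k) \<le> real (card (corner_sums (Suc n)))"
    unfolding rec sum.lessThan_Suc power_add
    by (intro mult_mono Suc asm_ratio_bounds) auto
  have "real (card (corner_sums n)) * asm_ratio n \<le> ((27 / 16) ^ (\<Sum>k<n. k) * fact n) * ((27 / 16) ^ n * (real n + 1))"
    by (intro mult_mono Suc asm_ratio_bounds) (auto simp: asm_ratio_def)
  then show "real (card (corner_sums (Suc n))) \<le> (27 / 16) ^ (\<Sum>k<Suc n. k) * fact (Suc n)"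
    unfolding rec by (simp add: power_add mult_ac add.commute)
qed (auto simp: card_corner_sums_0)

section \<open>Alternating sign matrices and corner sums\<close>

text \<open>A fictitious entry \<open>2 * h - 1\<close> in front encodes the current partial sum \<open>h\<close>:
after a partial sum 0 the next nonzero entry must be 1, as if the last one had
been \<open>-1\<close>, and conversely.\<close>

lemma successively_alternating_iff:
  fixes xs :: "int list"
  assumes "h \<in> {0, 1}"
  shows "set xs \<subseteq> {0, 1, -1} \<and>
      successively (\<lambda>x y. sgn y = - sgn x) ((2 * h - 1) # filter (\<lambda>x. x \<noteq> 0) xs) \<longleftrightarrow>
    (\<forall>k\<le>length xs. h + sum_list (take k xs) \<in> {0, 1})"
  using assms
proof (induction xs arbitrary: h)
  case (Cons x xs)
  have all_Suc: "(\<forall>k\<le>Suc n. P k) \<longleftrightarrow> P 0 \<and> (\<forall>k\<le>n. P (Suc k))" for n and P :: "nat \<Rightarrow> bool"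
    by (metis Suc_le_mono le0 not0_implies_Suc)
  show ?case
  proof (cases "h + x \<in> {0, 1}")
    case True
    have "(\<forall>k\<le>length (x # xs). h + sum_list (take k (x # xs)) \<in> {0, 1}) \<longleftrightarrow>
          (\<forall>k\<le>length xs. (h + x) + sum_list (take k xs) \<in> {0, 1})"
      using Cons.prems by (simp add: all_Suc add.assoc)
    also have "\<dots> \<longleftrightarrow> set xs \<subseteq> {0, 1, -1} \<and>
        successively (\<lambda>x y. sgn y = - sgn x) ((2 * (h + x) - 1) # filter (\<lambda>x. x \<noteq> 0) xs)"
      using Cons.IH[OF True] by blast
    finally have *: "(\<forall>k\<le>length (x # xs). h + sum_list (take k (x # xs)) \<in> {0, 1}) \<longleftrightarrow>
        set xs \<subseteq> {0, 1, -1} \<and>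
        successively (\<lambda>x y. sgn y = - sgn x) ((2 * (h + x) - 1) # filter (\<lambda>x. x \<noteq> 0) xs)" .
    consider "h = 0" "x = 0" | "h = 0" "x = 1" | "h = 1" "x = 0" | "h = 1" "x = -1"
      using True Cons.prems by fastforce
    then show ?thesis
      unfolding * by cases auto
  next
    case False
    then have "\<not> (\<forall>k\<le>length (x # xs). h + sum_list (take k (x # xs)) \<in> {0, 1})"
      by (auto intro!: exI[of _ 1])
    moreover have "\<not> (set (x # xs) \<subseteq> {0, 1, -1} \<and>
        successively (\<lambda>x y. sgn y = - sgn x) ((2 * h - 1) # filter (\<lambda>x. x \<noteq> 0) (x # xs)))"
      using False Cons.prems by auto
    ultimately show ?thesis by blast
  qed
qed auto

text \<open>An alternating list of sum 1 has to start with 1: if its first nonzero entry were \<open>-1\<close>, all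
partial sums would lie in \<open>{-1, 0}\<close>.\<close>

lemma alternating_sign_list_iff:
  "alternating_sign_list xs \<longleftrightarrow>
     (\<forall>k\<le>length xs. sum_list (take k xs) \<in> {0, 1}) \<and> sum_list xs = 1"
proof -
  let ?succ = "successively (\<lambda>x y :: int. sgn y = - sgn x)"
  let ?nz = "filter (\<lambda>x. x \<noteq> 0) xs"
  have iff: "set xs \<subseteq> {0, 1, -1} \<and> ?succ ((2 * h - 1) # ?nz) \<longleftrightarrow>
      (\<forall>k\<le>length xs. h + sum_list (take k xs) \<in> {0, 1})" if "h \<in> {0, 1}" for h
    using successively_alternating_iff[OF that] .
  show ?thesis
  proof
    assume alt: "alternating_sign_list xs"
    then have xs: "set xs \<subseteq> {0, 1, -1}" "?succ ?nz" "sum_list xs = 1"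
      by (auto simp: alternating_sign_list_def)
    have "?nz \<noteq> []"
    proof
      assume "?nz = []"
      then have "\<forall>x\<in>set xs. x = 0" by (simp add: filter_empty_conv)
      then have "sum_list xs = 0" by (induction xs) auto
      then show False using xs by simp
    qed
    then obtain y ys where y: "?nz = y # ys"
      by (cases ?nz) auto
    then have "y \<in> set xs \<and> y \<noteq> 0"
      by (metis (mono_tags, lifting) list.set_intros(1) mem_Collect_eq set_filter)
    then have "y = 1 \<or> y = -1" using xs(1) by auto
    then show "(\<forall>k\<le>length xs. sum_list (take k xs) \<in> {0, 1}) \<and> sum_list xs = 1"
    proof
      assume "y = 1"
      then have "?succ ((2 * 0 - 1) # ?nz)" using xs(2) y by simp
      then show ?thesis using iff[of 0] xs by simp
    next
      assume "y = -1"
      then have "?succ ((2 * 1 - 1) # ?nz)" using xs(2) y by simp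
      then have "1 + sum_list (take (length xs) xs) \<in> {0, 1}"
        using iff[of 1] xs(1) by blast
      then show ?thesis using xs(3) by simp
    qed
  next
    assume *: "(\<forall>k\<le>length xs. sum_list (take k xs) \<in> {0, 1}) \<and> sum_list xs = 1"
    then have "set xs \<subseteq> {0, 1, -1} \<and> ?succ ((2 * 0 - 1) # ?nz)"
      using iff[of 0] by simp
    then show "alternating_sign_list xs"
      using * by (auto simp: alternating_sign_list_def successively_Cons)
  qed
qed

lemma sum_list_take_list_of_vec:
  assumes "k \<le> dim_vec v"
  shows "sum_list (take k (list_of_vec v)) = (\<Sum>j<k. v $ j)"
  using assms
proof (induction k)
  case (Suc k)
  then show ?case
    by (simp add: take_Suc_conv_app_nth list_of_vec_index)
qed simp

lemma alternating_sign_list_of_vec_iff: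
  "alternating_sign_list (list_of_vec v) \<longleftrightarrow>
     (\<forall>k\<le>dim_vec v. (\<Sum>j<k. v $ j) \<in> {0, 1}) \<and> (\<Sum>j<dim_vec v. v $ j) = 1"
  using sum_list_take_list_of_vec[of _ v] sum_list_take_list_of_vec[of "dim_vec v" v]
  by (auto simp: alternating_sign_list_iff)

definition corner_sum :: "nat \<Rightarrow> int mat \<Rightarrow> nat \<Rightarrow> nat \<Rightarrow> int" where
  "corner_sum n A = (\<lambda>i j. if i \<le> n \<and> j \<le> n then \<Sum>i'<i. \<Sum>j'<j. A $$ (i', j') else 0)"

text \<open>The mixed second difference, which inverts \<open>corner_sum\<close>.\<close>

definition corner_diff :: "nat \<Rightarrow> (nat \<Rightarrow> nat \<Rightarrow> int) \<Rightarrow> int mat" where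
  "corner_diff n f = mat n n (\<lambda>(i, j). f (Suc i) (Suc j) - f (Suc i) j - (f i (Suc j) - f i j))"

lemma alternating_sign_matrix_iff:
  assumes A: "A \<in> carrier_mat n n"
  shows "alternating_sign_matrix A \<longleftrightarrow> corner_sum n A \<in> corner_sums n"
proof -
  let ?f = "corner_sum n A"
  have row: "?f (Suc i) j - ?f i j = (\<Sum>j'<j. A $$ (i, j'))" if "i < n" "j \<le> n" for i j
    using that by (simp add: corner_sum_def)
  have col: "?f j (Suc i) - ?f j i = (\<Sum>j'<j. A $$ (j', i))" if "i < n" "j \<le> n" for i j
    using that by (simp add: corner_sum_def sum.distrib)
  have ASM: "alternating_sign_matrix A \<longleftrightarrow>
      (\<forall>i<n. (\<forall>k\<le>n. ?f (Suc i) k - ?f i k \<in> {0, 1}) \<and> ?f (Suc i) n - ?f i n = 1) \<and>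
      (\<forall>i<n. (\<forall>k\<le>n. ?f k (Suc i) - ?f k i \<in> {0, 1}) \<and> ?f n (Suc i) - ?f n i = 1)"
  proof -
    have "(\<Sum>j<k. row A i $ j) = ?f (Suc i) k - ?f i k" "(\<Sum>j<k. col A i $ j) = ?f k (Suc i) - ?f k i"
      if "i < n" "k \<le> n" for i k
      using that A by (simp_all add: row col)
    then show ?thesis
      using A unfolding alternating_sign_matrix_def alternating_sign_list_of_vec_iff
      by (simp add: carrier_matD square_mat.simps)
  qed
  have zero: "?f 0 i = 0" "?f i 0 = 0" for i
    by (auto simp: corner_sum_def)
  have outside: "?f i j = 0" if "n < i \<or> n < j" for i j
    using that by (auto simp: corner_sum_def)
  have last: "(\<forall>i<n. ?f (Suc i) n - ?f i n = 1) \<longleftrightarrow> (\<forall>i\<le>n. ?f i n = int i)"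
    "(\<forall>i<n. ?f n (Suc i) - ?f n i = 1) \<longleftrightarrow> (\<forall>i\<le>n. ?f n i = int i)"
  proof -
    have *: "(\<forall>i<n. g (Suc i) - g i = 1) \<longleftrightarrow> (\<forall>i\<le>n. g i = int i)" if "g 0 = 0" for g :: "nat \<Rightarrow> int"
    proof
      assume g: "\<forall>i<n. g (Suc i) - g i = 1"
      have "g i = int i" if "i \<le> n" for i
        using that
      proof (induction i)
        case (Suc i)
        then have "i < n" "g i = int i" by auto
        moreover from this have "g (Suc i) - g i = 1" using g by blast
        ultimately show ?case by simp
      qed (use \<open>g 0 = 0\<close> in simp)
      then show "\<forall>i\<le>n. g i = int i" by blast
    qed auto
    show "(\<forall>i<n. ?f (Suc i) n - ?f i n = 1) \<longleftrightarrow> (\<forall>i\<le>n. ?f i n = int i)"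
      "(\<forall>i<n. ?f n (Suc i) - ?f n i = 1) \<longleftrightarrow> (\<forall>i\<le>n. ?f n i = int i)"
      by (rule *, simp add: zero)+
  qed
  have "?f \<in> corner_sums n \<longleftrightarrow>
      (\<forall>i\<le>n. ?f n i = int i \<and> ?f i n = int i) \<and>
      (\<forall>i<n. \<forall>j\<le>n. ?f (Suc i) j - ?f i j \<in> {0, 1} \<and> ?f j (Suc i) - ?f j i \<in> {0, 1})"
    unfolding corner_sums_def using zero outside by simp
  then show ?thesis
    unfolding ASM using last by blast
qed

lemma corner_diff_corner_sum:
  assumes "A \<in> carrier_mat n n"
  shows "corner_diff n (corner_sum n A) = A"
  using assms by (intro eq_matI) (auto simp: corner_diff_def corner_sum_def sum.distrib)

lemma corner_sum_corner_diff:
  assumes f: "f \<in> corner_sums n"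
  shows "corner_sum n (corner_diff n f) = f"
proof (intro ext)
  fix i j
  show "corner_sum n (corner_diff n f) i j = f i j"
  proof (cases "i \<le> n \<and> j \<le> n")
    case True
    have "corner_sum n (corner_diff n f) i j =
        (\<Sum>i'<i. \<Sum>j'<j. (f (Suc i') (Suc j') - f (Suc i') j') - (f i' (Suc j') - f i' j'))"
      using True by (auto simp: corner_sum_def corner_diff_def intro!: sum.cong)
    also have "\<dots> = (\<Sum>i'<i. (f (Suc i') j - f (Suc i') 0) - (f i' j - f i' 0))"
      by (intro sum.cong refl, subst sum_subtractf) (simp only: sum_lessThan_telescope)
    also have "\<dots> = (\<Sum>i'<i. f (Suc i') j - f i' j)"
      using f True by (intro sum.cong) (auto simp: corner_sums_def)
    also have "\<dots> = f i j"
      using f True sum_lessThan_telescope[of "\<lambda>i'. f i' j" i] by (simp add: corner_sums_def)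
    finally show ?thesis .
  next
    case False
    then show ?thesis using f by (auto simp: corner_sum_def corner_sums_def)
  qed
qed

section \<open>Symmetric corner sums and DSASMs\<close>

definition symmetric_corner_sums :: "nat \<Rightarrow> (nat \<Rightarrow> nat \<Rightarrow> int) set" where
  "symmetric_corner_sums n = {f \<in> corner_sums n. \<forall>i j. f i j = f j i}"

lemma finite_symmetric_corner_sums: "finite (symmetric_corner_sums n)"
  unfolding symmetric_corner_sums_def using finite_corner_sums by simp

lemma corner_sum_DSASM:
  assumes "A \<in> DSASM n k"
  shows "corner_sum n A \<in> symmetric_corner_sums n"
proof -
  have A: "A \<in> carrier_mat n n" "alternating_sign_matrix A" "transpose_mat A = A"
    using assms by (auto simp: DSASM_def)
  have sym: "A $$ (i, j) = A $$ (j, i)" if "i < n" "j < n" for i j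
    using that A(1) by (subst A(3) [symmetric]) simp
  have "corner_sum n A i j = corner_sum n A j i" for i j
  proof (cases "i \<le> n \<and> j \<le> n")
    case True
    then have "(\<Sum>i'<i. \<Sum>j'<j. A $$ (i', j')) = (\<Sum>i'<i. \<Sum>j'<j. A $$ (j', i'))"
      by (intro sum.cong refl sym) auto
    also have "\<dots> = (\<Sum>j'<j. \<Sum>i'<i. A $$ (j', i'))"
      by (rule sum.swap)
    finally show ?thesis using True by (simp add: corner_sum_def)
  qed (auto simp: corner_sum_def)
  then show ?thesis
    using A alternating_sign_matrix_iff by (auto simp: symmetric_corner_sums_def)
qed

lemma inj_on_corner_sum: "inj_on (corner_sum n) (DSASM n k)"
proof (rule inj_on_inverseI)
  fix A assume "A \<in> DSASM n k"
  then show "corner_diff n (corner_sum n A) = A"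
    by (intro corner_diff_corner_sum) (simp add: DSASM_def)
qed

lemma finite_DSASM: "finite (DSASM n k)"
  by (rule inj_on_finite[OF inj_on_corner_sum _ finite_symmetric_corner_sums])
     (use corner_sum_DSASM in blast)

lemma card_DSASM_le: "card (DSASM n k) \<le> card (symmetric_corner_sums n)"
  by (rule card_inj_on_le[OF inj_on_corner_sum _ finite_symmetric_corner_sums])
     (use corner_sum_DSASM in blast)

lemma corner_diff_DSASM:
  assumes f: "f \<in> symmetric_corner_sums n" and k: "k \<in> {1..n}"
    and row: "\<And>j. j \<le> n \<Longrightarrow> f 1 j = of_bool (k \<le> j)"
  shows "corner_diff n f \<in> DSASM n k"
proof -
  have f': "f \<in> corner_sums n" and sym: "f i j = f j i" for i j
    using f by (auto simp: symmetric_corner_sums_def)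
  have carrier: "corner_diff n f \<in> carrier_mat n n"
    by (simp add: corner_diff_def)
  have "alternating_sign_matrix (corner_diff n f)"
    using alternating_sign_matrix_iff[OF carrier] f' by (simp add: corner_sum_corner_diff)
  moreover have "transpose_mat (corner_diff n f) = corner_diff n f"
    by (rule eq_matI) (auto simp: corner_diff_def sym)
  moreover have "corner_diff n f $$ (0, k - 1) = 1"
    using k f' row[of k] row[of "k - 1"]
    by (auto simp: corner_diff_def corner_sums_def)
  ultimately show ?thesis
    using carrier k by (simp add: DSASM_def)
qed

text \<open>The position of the 1 in the first row is visible in corner sums as the place where
\<open>f 1 j\<close> jumps. Lower bounds for the number of matrices with a given position thus follow
from injections between sets of corner sums.\<close>

lemma card_le_card_DSASM:
  assumes k: "k \<in> {1..n}" and inj: "inj_on h (symmetric_corner_sums m)"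
    and h: "\<And>f. f \<in> symmetric_corner_sums m \<Longrightarrow> h f \<in> symmetric_corner_sums n"
    and row: "\<And>f j. f \<in> symmetric_corner_sums m \<Longrightarrow> j \<le> n \<Longrightarrow> h f 1 j = of_bool (k \<le> j)"
  shows "card (symmetric_corner_sums m) \<le> card (DSASM n k)"
proof (rule card_inj_on_le[OF _ _ finite_DSASM])
  have "inj_on (corner_diff n) (corner_sums n)"
    by (rule inj_on_inverseI) (rule corner_sum_corner_diff)
  then have "inj_on (corner_diff n) (h ` symmetric_corner_sums m)"
    by (rule inj_on_subset) (use h in \<open>auto simp: symmetric_corner_sums_def\<close>)
  then show "inj_on (corner_diff n \<circ> h) (symmetric_corner_sums m)"
    by (rule comp_inj_on[OF inj])
  show "(corner_diff n \<circ> h) ` symmetric_corner_sums m \<subseteq> DSASM n k"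
    using corner_diff_DSASM[OF h k row] by auto
qed

text \<open>The corner sums of the block diagonal matrix with blocks 1 and the given matrix.\<close>

definition insert_fixed :: "nat \<Rightarrow> (nat \<Rightarrow> nat \<Rightarrow> int) \<Rightarrow> nat \<Rightarrow> nat \<Rightarrow> int" where
  "insert_fixed n f = (\<lambda>i j. if i \<le> n \<and> j \<le> n then of_bool (1 \<le> i \<and> 1 \<le> j) + f (i - 1) (j - 1) else 0)"

text \<open>The corner sums of the matrix that has the transposition of the indices 1 and \<open>k\<close> on these two
rows and columns and the given matrix on the remaining ones. The argument of \<open>f\<close> is the number
of remaining indices among the first \<open>i\<close>.\<close>

definition insert_transposition :: "nat \<Rightarrow> nat \<Rightarrow> (nat \<Rightarrow> nat \<Rightarrow> int) \<Rightarrow> nat \<Rightarrow> nat \<Rightarrow> int" where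
  "insert_transposition n k f = (\<lambda>i j. if i \<le> n \<and> j \<le> n
     then of_bool (1 \<le> i \<and> k \<le> j) + of_bool (k \<le> i \<and> 1 \<le> j) +
       f (i - of_bool (1 \<le> i) - of_bool (k \<le> i)) (j - of_bool (1 \<le> j) - of_bool (k \<le> j))
     else 0)"

lemma symmetric_corner_sumsI:
  assumes "\<And>i j. n < i \<or> n < j \<Longrightarrow> f i j = 0" "\<And>i j. f i j = f j i"
    and "\<And>j. j \<le> n \<Longrightarrow> f 0 j = 0" "\<And>j. j \<le> n \<Longrightarrow> f n j = int j"
    and "\<And>i j. i < n \<Longrightarrow> j \<le> n \<Longrightarrow> f (Suc i) j - f i j \<in> {0, 1}"
  shows "f \<in> symmetric_corner_sums n"
proof -
  have ends: "f i 0 = 0" "f i n = int i" if "i \<le> n" for i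
    using assms(3,4)[OF that] by (simp_all add: assms(2)[of i])
  have col: "f j (Suc i) - f j i \<in> {0, 1}" if "i < n" "j \<le> n" for i j
    using assms(5)[OF that] assms(2)[of j] by simp
  show ?thesis
    unfolding symmetric_corner_sums_def corner_sums_def mem_Collect_eq
  proof (intro conjI allI impI)
    show "f i j = f j i" for i j by (rule assms(2))
  qed (use assms(1,3,4,5) ends col in auto)
qed

lemma card_symmetric_le_DSASM_1:
  assumes n: "1 \<le> n"
  shows "card (symmetric_corner_sums (n - 1)) \<le> card (DSASM n 1)"
proof (rule card_le_card_DSASM[where h = "insert_fixed n"])
  show "1 \<in> {1..n}" using n by simp
  show "inj_on (insert_fixed n) (symmetric_corner_sums (n - 1))"
  proof (rule inj_onI)
    fix f g assume fg: "f \<in> symmetric_corner_sums (n - 1)" "g \<in> symmetric_corner_sums (n - 1)"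
      and eq: "insert_fixed n f = insert_fixed n g"
    have "f i j = g i j" if "i \<le> n - 1" "j \<le> n - 1" for i j
    proof -
      have "Suc i \<le> n" "Suc j \<le> n" using that n by auto
      then show ?thesis
        using fun_cong[OF fun_cong[OF eq], of "Suc i" "Suc j"] by (simp add: insert_fixed_def)
    qed
    moreover have "f i j = g i j" if "n - 1 < i \<or> n - 1 < j" for i j
      using that fg by (auto simp: symmetric_corner_sums_def corner_sums_def)
    ultimately show "f = g"
      by (intro ext) (meson not_le)
  qed
  fix f assume f: "f \<in> symmetric_corner_sums (n - 1)"
  then have corner: "f \<in> corner_sums (n - 1)" by (simp add: symmetric_corner_sums_def)
  then have f': "f 0 j = 0" "f (n - 1) j = int j" if "j \<le> n - 1" for j
    using that by (auto simp: corner_sums_def)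
  have step: "f (Suc i) j - f i j \<in> {0, 1}" if "i < n - 1" "j \<le> n - 1" for i j
    using corner that by (simp add: corner_sums_def)
  show "insert_fixed n f \<in> symmetric_corner_sums n"
  proof (rule symmetric_corner_sumsI)
    show "insert_fixed n f i j = insert_fixed n f j i" for i j
      using f by (auto simp: insert_fixed_def symmetric_corner_sums_def)
    show "insert_fixed n f (Suc i) j - insert_fixed n f i j \<in> {0, 1}" if "i < n" "j \<le> n" for i j
      using that step[of "i - 1" "j - 1"] f'(1)[of "j - 1"]
      by (cases i; cases j) (auto simp: insert_fixed_def)
  qed (use n f' in \<open>auto simp: insert_fixed_def\<close>)
  show "insert_fixed n f 1 j = of_bool (1 \<le> j)" if "j \<le> n" for j
    using that n f'(1)[of "j - 1"] by (simp add: insert_fixed_def)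
qed

lemma card_symmetric_le_DSASM:
  assumes k: "2 \<le> k" "k \<le> n"
  shows "card (symmetric_corner_sums (n - 2)) \<le> card (DSASM n k)"
proof (rule card_le_card_DSASM[where h = "insert_transposition n k"])
  define \<sigma> where "\<sigma> i = i - of_bool (1 \<le> i) - of_bool (k \<le> i)" for i :: nat
  have ins: "insert_transposition n k f i j = (if i \<le> n \<and> j \<le> n
      then of_bool (1 \<le> i \<and> k \<le> j) + of_bool (k \<le> i \<and> 1 \<le> j) + f (\<sigma> i) (\<sigma> j) else 0)" for f i j
    by (simp add: insert_transposition_def \<sigma>_def)
  have \<sigma>_le: "\<sigma> i \<le> n - 2" if "i \<le> n" for i
    using that k by (auto simp: \<sigma>_def)
  have \<sigma>_surj: "\<exists>i\<le>n. \<sigma> i = a" if "a \<le> n - 2" for a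
  proof (cases "a + 1 < k")
    case True
    then show ?thesis using that k by (intro exI[of _ "a + 1"]) (auto simp: \<sigma>_def)
  next
    case False
    then show ?thesis using that k by (intro exI[of _ "a + 2"]) (auto simp: \<sigma>_def)
  qed
  have \<sigma>_ends: "\<sigma> 0 = 0" "\<sigma> 1 = 0" "\<sigma> n = n - 2"
    using k by (auto simp: \<sigma>_def)
  show "k \<in> {1..n}" using k by simp
  show "inj_on (insert_transposition n k) (symmetric_corner_sums (n - 2))"
  proof (rule inj_onI)
    fix f g assume fg: "f \<in> symmetric_corner_sums (n - 2)" "g \<in> symmetric_corner_sums (n - 2)"
      and eq: "insert_transposition n k f = insert_transposition n k g"
    have "f (\<sigma> i) (\<sigma> j) = g (\<sigma> i) (\<sigma> j)" if "i \<le> n" "j \<le> n" for i j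
      using fun_cong[OF fun_cong[OF eq], of i j] that by (simp add: ins)
    then have "f i j = g i j" if "i \<le> n - 2" "j \<le> n - 2" for i j
      using \<sigma>_surj that by metis
    moreover have "f i j = g i j" if "n - 2 < i \<or> n - 2 < j" for i j
      using that fg by (auto simp: symmetric_corner_sums_def corner_sums_def)
    ultimately show "f = g"
      by (intro ext) (meson not_le)
  qed
  fix f assume f: "f \<in> symmetric_corner_sums (n - 2)"
  then have corner: "f \<in> corner_sums (n - 2)" by (simp add: symmetric_corner_sums_def)
  then have f': "f 0 j = 0" "f (n - 2) j = int j" if "j \<le> n - 2" for j
    using that by (auto simp: corner_sums_def)
  have step: "f (Suc i) j - f i j \<in> {0, 1}" if "i < n - 2" "j \<le> n - 2" for i j
    using corner that by (simp add: corner_sums_def)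
  show "insert_transposition n k f \<in> symmetric_corner_sums n"
  proof (rule symmetric_corner_sumsI)
    show "insert_transposition n k f i j = insert_transposition n k f j i" for i j
      using f by (auto simp: ins symmetric_corner_sums_def)
    show "insert_transposition n k f (Suc i) j - insert_transposition n k f i j \<in> {0, 1}"
      if "i < n" "j \<le> n" for i j
    proof -
      consider "i = 0" | "0 < i" "Suc i = k" | "0 < i" "Suc i \<noteq> k"
        by blast
      then show ?thesis
      proof cases
        case 1
        then show ?thesis using that k f'(1)[OF \<sigma>_le] \<sigma>_ends by (simp add: ins)
      next
        case 2
        then have "\<sigma> (Suc i) = \<sigma> i" by (simp add: \<sigma>_def)
        then show ?thesis using that 2 by (simp add: ins)
      next
        case 3
        then have "\<sigma> (Suc i) = Suc (\<sigma> i)" "\<sigma> i < n - 2"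
          using k that by (auto simp: \<sigma>_def)
        then show ?thesis
          using that 3 step[of "\<sigma> i" "\<sigma> j"] \<sigma>_le[of j] by (auto simp: ins)
      qed
    qed
    show "insert_transposition n k f n j = int j" if "j \<le> n" for j
      using that k f'(2)[OF \<sigma>_le[OF that]] by (simp add: ins \<sigma>_ends) (auto simp: \<sigma>_def)
  qed (use k f' \<sigma>_le \<sigma>_ends in \<open>auto simp: ins\<close>)
  show "insert_transposition n k f 1 j = of_bool (k \<le> j)" if "j \<le> n" for j
    using that k f'(1)[OF \<sigma>_le[OF that]] \<sigma>_ends by (simp add: ins)
qed

lemma card_DSASM_ge:
  assumes "k \<in> {1..n}" "2 \<le> n"
  shows "card (symmetric_corner_sums (n - 2)) \<le> card (DSASM n k)"
proof (cases "k = 1")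
  case True
  \<comment> \<open>Two fixed indices are inserted one after the other.\<close>
  have "card (symmetric_corner_sums (n - 1 - 1)) \<le> card (DSASM (n - 1) 1)"
    using assms by (intro card_symmetric_le_DSASM_1) simp
  also have "\<dots> \<le> card (symmetric_corner_sums (n - 1))"
    by (rule card_DSASM_le)
  also have "\<dots> \<le> card (DSASM n 1)"
    using assms by (intro card_symmetric_le_DSASM_1) simp
  finally show ?thesis using True by (simp add: numeral_2_eq_2)
next
  case False
  then show ?thesis using assms by (intro card_symmetric_le_DSASM) auto
qed

section \<open>Gluing along the diagonal\<close>

text \<open>The part of \<open>s\<close> on and above the diagonal together with the part of \<open>t\<close> below it.\<close>

definition glue :: "(nat \<Rightarrow> nat \<Rightarrow> int) \<Rightarrow> (nat \<Rightarrow> nat \<Rightarrow> int) \<Rightarrow> nat \<Rightarrow> nat \<Rightarrow> int" where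
  "glue s t = (\<lambda>i j. if i \<le> j then s i j else t i j)"

text \<open>Neighbouring positions never lie on opposite sides of the diagonal, so agreement on the
diagonal suffices.\<close>

lemma glue_corner_sums:
  assumes s: "s \<in> corner_sums n" and t: "t \<in> corner_sums n" and diag: "\<And>i. i \<le> n \<Longrightarrow> s i i = t i i"
  shows "glue s t \<in> corner_sums n"
proof -
  have "glue s t (Suc i) j - glue s t i j \<in> {0, 1}" "glue s t j (Suc i) - glue s t j i \<in> {0, 1}"
    if "i < n" "j \<le> n" for i j
  proof -
    have "s (Suc i) j - s i j \<in> {0, 1}" "t (Suc i) j - t i j \<in> {0, 1}"
      "s j (Suc i) - s j i \<in> {0, 1}" "t j (Suc i) - t j i \<in> {0, 1}"
      using s t that by (simp_all add: corner_sums_def)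
    then show "glue s t (Suc i) j - glue s t i j \<in> {0, 1}" "glue s t j (Suc i) - glue s t j i \<in> {0, 1}"
      using diag[of j] that unfolding glue_def
      by (cases "i = j"; cases "Suc i = j"; simp add: le_Suc_eq)+
  qed
  then show ?thesis
    using s t by (simp add: corner_sums_def) (simp add: glue_def)
qed

text \<open>Reflecting the upper and the lower half of an alternating sign matrix gives two symmetric
corner sums, which together determine the matrix.\<close>

lemma card_corner_sums_le: "card (corner_sums n) \<le> card (symmetric_corner_sums n) ^ 2"
proof -
  let ?t = "\<lambda>f :: nat \<Rightarrow> nat \<Rightarrow> int. \<lambda>i j. f j i"
  have transpose: "?t f \<in> corner_sums n" if "f \<in> corner_sums n" for f
    using that by (auto simp: corner_sums_def)
  have glue: "glue f (?t f) \<in> symmetric_corner_sums n" if "f \<in> corner_sums n" for f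
    using glue_corner_sums[OF that transpose[OF that]]
    by (auto simp: symmetric_corner_sums_def glue_def)
  let ?h = "\<lambda>f. (glue f (?t f), glue (?t f) f)"
  have "card (corner_sums n) \<le> card (symmetric_corner_sums n \<times> symmetric_corner_sums n)"
  proof (rule card_inj_on_le)
    show "inj_on ?h (corner_sums n)"
    proof (intro inj_onI ext)
      fix f g :: "nat \<Rightarrow> nat \<Rightarrow> int" and i j
      assume "?h f = ?h g"
      then have "glue f (?t f) i j = glue g (?t g) i j" "glue (?t f) f i j = glue (?t g) g i j"
        by auto
      then show "f i j = g i j" by (cases "i \<le> j") (auto simp: glue_def)
    qed
    show "?h ` corner_sums n \<subseteq> symmetric_corner_sums n \<times> symmetric_corner_sums n"
      using glue glue[OF transpose] by auto
  qed (simp add: finite_symmetric_corner_sums)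
  then show ?thesis by (simp add: power2_eq_square card_cartesian_product)
qed

lemma corner_sums_range:
  assumes "f \<in> corner_sums n" "i \<le> n" "j \<le> n"
  shows "0 \<le> f i j" "f i j \<le> int j"
proof -
  have "0 \<le> f i j \<and> f i j \<le> int j"
    using assms(3)
  proof (induction j)
    case 0
    then show ?case using assms by (auto simp: corner_sums_def)
  next
    case (Suc j)
    then have "f i (Suc j) - f i j \<in> {0, 1}"
      using assms by (simp add: corner_sums_def)
    then show ?case using Suc by auto
  qed
  then show "0 \<le> f i j" "f i j \<le> int j" by auto
qed

text \<open>Two symmetric corner sums with the same diagonal can be glued to a corner sum, so the square
of the size of each fibre of the diagonal map is at most the number of alternating sign
matrices. There are at most \<open>(n + 1) ^ (n + 1)\<close> diagonals, and the largest fibre has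
at least the average size. This loses only a factor whose logarithm is \<open>o(n\<^sup>2)\<close>.\<close>

lemma card_symmetric_corner_sums_le:
  "card (symmetric_corner_sums n) ^ 2 \<le> ((n + 1) ^ (n + 1)) ^ 2 * card (corner_sums n)"
proof -
  let ?S = "symmetric_corner_sums n"
  define diag where "diag f = restrict (\<lambda>i. f i i) {..n}" for f :: "nat \<Rightarrow> nat \<Rightarrow> int"
  let ?D = "diag ` ?S" and ?fibre = "\<lambda>d. {f \<in> ?S. diag f = d}"
  have S_subset: "?S \<subseteq> corner_sums n"
    by (auto simp: symmetric_corner_sums_def)
  have "?D \<subseteq> {..n} \<rightarrow>\<^sub>E {0..int n}"
    using corner_sums_range S_subset by (force simp: diag_def)
  then have "card ?D \<le> card ({..n} \<rightarrow>\<^sub>E {0..int n})"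
    by (intro card_mono finite_PiE) auto
  also have "\<dots> = (n + 1) ^ (n + 1)"
    by (simp add: card_PiE nat_add_distrib)
  finally have card_D: "card ?D \<le> (n + 1) ^ (n + 1)" .
  have fibre: "card (?fibre d) ^ 2 \<le> card (corner_sums n)" for d
  proof -
    have "card (?fibre d \<times> ?fibre d) \<le> card (corner_sums n)"
    proof (rule card_inj_on_le)
      show "inj_on (\<lambda>(s, t). glue s t) (?fibre d \<times> ?fibre d)"
      proof (rule inj_onI, clarify)
        fix s t s' t'
        assume S: "s \<in> ?S" "t \<in> ?S" "s' \<in> ?S" "t' \<in> ?S"
          and d: "diag t = diag s" "diag s' = diag s" "diag t' = diag s"
          and eq: "glue s t = glue s' t'"
        have "s i j = s' i j" if "i \<le> j" for i j
          using fun_cong[OF fun_cong[OF eq], of i j] that by (simp add: glue_def)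
        then have "s = s'"
          using S by (intro ext) (metis (mono_tags, lifting) mem_Collect_eq nle_le symmetric_corner_sums_def)
        moreover have "t i j = t' i j" if "j < i" for i j
          using fun_cong[OF fun_cong[OF eq], of i j] that by (simp add: glue_def)
        moreover have "t i i = t' i i" for i
        proof (cases "i \<le> n")
          case True
          moreover have "diag t i = diag t' i" using d by simp
          ultimately show ?thesis by (simp add: diag_def)
        next
          case False
          then show ?thesis using S by (auto simp: symmetric_corner_sums_def corner_sums_def)
        qed
        ultimately have "t = t'"
          using S by (intro ext) (metis (mono_tags, lifting) mem_Collect_eq linorder_neqE_nat symmetric_corner_sums_def)
        with \<open>s = s'\<close> show "s = s' \<and> t = t'" by simp
      qed
      have "s i i = t i i" if "diag s = diag t" "i \<le> n" for s t i
        using fun_cong[OF that(1), of i] that(2) by (simp add: diag_def)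
      then show "(\<lambda>(s, t). glue s t) ` (?fibre d \<times> ?fibre d) \<subseteq> corner_sums n"
        using S_subset by (auto intro!: glue_corner_sums)
    qed (rule finite_corner_sums)
    then show ?thesis by (simp add: power2_eq_square card_cartesian_product)
  qed
  have fin: "finite ?D"
    using finite_symmetric_corner_sums by simp
  show ?thesis
  proof (cases "?S = {}")
    case False
    define M where "M = Max ((\<lambda>d. card (?fibre d)) ` ?D)"
    have "M \<in> (\<lambda>d. card (?fibre d)) ` ?D"
      unfolding M_def using fin False by (intro Max_in) auto
    then have M: "M ^ 2 \<le> card (corner_sums n)" using fibre by auto
    have "card ?S = (\<Sum>d\<in>?D. card (?fibre d))"
      using sum.image_gen[OF finite_symmetric_corner_sums, of "\<lambda>_. 1 :: nat" n diag] by simp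
    also have "\<dots> \<le> (\<Sum>d\<in>?D. M)"
      unfolding M_def using fin by (intro sum_mono Max_ge) auto
    also have "\<dots> \<le> (n + 1) ^ (n + 1) * M"
      using card_D by simp
    finally have "card ?S ^ 2 \<le> ((n + 1) ^ (n + 1) * M) ^ 2"
      by (rule power_mono) simp
    also have "\<dots> \<le> ((n + 1) ^ (n + 1)) ^ 2 * card (corner_sums n)"
      using M by (simp only: power_mult_distrib mult_le_mono2)
    finally show ?thesis .
  qed simp
qed

section \<open>Asymptotics\<close>

lemma real_sum_lessThan: "real (\<Sum>k<n. k) = real n * (real n - 1) / 2"
  by (induction n) (simp_all add: field_simps)

lemma card_DSASM_lower:
  assumes "k \<in> {1..n}" "2 \<le> n"
  shows "(27 / 16) powr ((real n - 2) * (real n - 3) / (2 * (real n)\<^sup>2)) \<le> real (card (DSASM n k)) powr (2 / (real n)\<^sup>2)"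
proof -
  let ?e = "\<Sum>k<n - 2. k"
  have "(27 / 16) ^ ?e \<le> real (card (corner_sums (n - 2)))"
    by (rule card_corner_sums_bounds)
  also have "\<dots> \<le> real (card (symmetric_corner_sums (n - 2)) ^ 2)"
    by (simp only: of_nat_le_iff card_corner_sums_le)
  also have "\<dots> \<le> real (card (DSASM n k)) ^ 2"
    using card_DSASM_ge[OF assms] by (simp add: power_mono)
  finally have le: "(27 / 16) ^ ?e \<le> real (card (DSASM n k)) ^ 2" .
  have e: "real ?e = (real n - 2) * (real n - 3) / 2"
    using assms(2) unfolding real_sum_lessThan by (simp add: of_nat_diff)
  have "(27 / 16) powr ((real n - 2) * (real n - 3) / (2 * (real n)\<^sup>2)) = ((27 / 16) powr real ?e) powr (1 / (real n)\<^sup>2)"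
    unfolding powr_powr e by simp
  also have "\<dots> = ((27 / 16) ^ ?e) powr (1 / (real n)\<^sup>2)"
    by (subst powr_realpow) simp_all
  also have "\<dots> \<le> (real (card (DSASM n k)) ^ 2) powr (1 / (real n)\<^sup>2)"
    using le by (intro powr_mono2) auto
  also have "\<dots> = real (card (DSASM n k)) powr (2 / (real n)\<^sup>2)"
    by (cases "card (DSASM n k) = 0") (auto simp: powr_powr simp flip: powr_numeral)
  finally show ?thesis .
qed

lemma card_DSASM_upper:
  assumes "1 \<le> n"
  shows "real (card (DSASM n k)) powr (2 / (real n)\<^sup>2) \<le>
    (27 / 16) powr (real n * (real n - 1) / (2 * (real n)\<^sup>2)) * (real n + 1) powr ((3 * real n + 2) / (real n)\<^sup>2)"
proof -
  let ?e = "\<Sum>k<n. k"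
  have "real (card (DSASM n k)) ^ 2 \<le> real (card (symmetric_corner_sums n) ^ 2)"
    using card_DSASM_le by (simp add: power_mono)
  also have "\<dots> \<le> real (((n + 1) ^ (n + 1)) ^ 2 * card (corner_sums n))"
    by (simp only: of_nat_le_iff card_symmetric_corner_sums_le)
  also have "\<dots> = (real n + 1) ^ (2 * n + 2) * real (card (corner_sums n))"
  proof -
    have "(n + 1) * 2 = 2 * n + 2" by simp
    then show ?thesis
      by (simp only: power_mult [symmetric] of_nat_mult of_nat_power of_nat_add of_nat_1)
  qed
  also have "\<dots> \<le> (real n + 1) ^ (2 * n + 2) * ((27 / 16) ^ ?e * (real n + 1) ^ n)"
  proof (intro mult_left_mono)
    have "fact n \<le> (real n + 1) ^ n"
    proof -
      have "fact n \<le> real n ^ n" using fact_le_power[of n] by simp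
      also have "\<dots> \<le> (real n + 1) ^ n" by (intro power_mono) auto
      finally show ?thesis .
    qed
    then show "real (card (corner_sums n)) \<le> (27 / 16) ^ ?e * (real n + 1) ^ n"
      by (intro order.trans[OF card_corner_sums_bounds(2)] mult_left_mono) auto
  qed auto
  also have "\<dots> = (27 / 16) ^ ?e * (real n + 1) ^ (3 * n + 2)"
    by (simp add: mult_ac flip: power_add)
  finally have le: "real (card (DSASM n k)) ^ 2 \<le> (27 / 16) ^ ?e * (real n + 1) ^ (3 * n + 2)" .
  have "real (card (DSASM n k)) powr (2 / (real n)\<^sup>2) = (real (card (DSASM n k)) ^ 2) powr (1 / (real n)\<^sup>2)"
    by (cases "card (DSASM n k) = 0") (auto simp: powr_powr simp flip: powr_numeral)
  also have "\<dots> \<le> ((27 / 16) ^ ?e * (real n + 1) ^ (3 * n + 2)) powr (1 / (real n)\<^sup>2)"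
    using le by (intro powr_mono2) auto
  also have "\<dots> = ((27 / 16) powr real ?e) powr (1 / (real n)\<^sup>2) *
      ((real n + 1) powr real (3 * n + 2)) powr (1 / (real n)\<^sup>2)"
    by (simp only: powr_mult powr_realpow zero_less_divide_iff zero_less_numeral simp_thms add_nonneg_pos of_nat_0_le_iff zero_less_one)
  also have "\<dots> = (27 / 16) powr (real n * (real n - 1) / (2 * (real n)\<^sup>2)) * (real n + 1) powr ((3 * real n + 2) / (real n)\<^sup>2)"
    unfolding powr_powr real_sum_lessThan by (simp add: add.commute)
  finally show ?thesis .
qed

theorem proposition11p3:
  fixes k :: "nat \<Rightarrow> nat"
  assumes "\<forall>\<^sub>F n in sequentially. k n \<in> {1..n}"
  shows "(\<lambda>n. real (card (DSASM n (k n))) powr (2 / (real n)\<^sup>2)) \<longlonglongrightarrow> 3 * sqrt 3 / 4"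
proof (rule tendsto_sandwich)
  show "\<forall>\<^sub>F n in sequentially. (27 / 16) powr ((real n - 2) * (real n - 3) / (2 * (real n)\<^sup>2)) \<le> real (card (DSASM n (k n))) powr (2 / (real n)\<^sup>2)"
    using assms eventually_ge_at_top[of 2] by eventually_elim (rule card_DSASM_lower)
  show "\<forall>\<^sub>F n in sequentially. real (card (DSASM n (k n))) powr (2 / (real n)\<^sup>2) \<le>
    (27 / 16) powr (real n * (real n - 1) / (2 * (real n)\<^sup>2)) * (real n + 1) powr ((3 * real n + 2) / (real n)\<^sup>2)"
    using eventually_ge_at_top[of 1] by eventually_elim (rule card_DSASM_upper)
  have "sqrt 27 = sqrt (3\<^sup>2 * 3)" by simp
  also have "\<dots> = 3 * sqrt 3" by (simp only: real_sqrt_mult real_sqrt_abs abs_numeral)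
  finally have limit: "(27 / 16) powr (1 / 2) = 3 * sqrt 3 / 4"
    by (simp add: powr_half_sqrt real_sqrt_divide)
  have "(\<lambda>n. (real n - 2) * (real n - 3) / (2 * (real n)\<^sup>2)) \<longlonglongrightarrow> 1 / 2"
    by real_asymp
  then show "(\<lambda>n. (27 / 16) powr ((real n - 2) * (real n - 3) / (2 * (real n)\<^sup>2))) \<longlonglongrightarrow> 3 * sqrt 3 / 4"
    unfolding limit [symmetric] by (rule tendsto_powr [OF tendsto_const]) simp
  have "(\<lambda>n. real n * (real n - 1) / (2 * (real n)\<^sup>2)) \<longlonglongrightarrow> 1 / 2"
    by real_asymp
  then have "(\<lambda>n. (27 / 16) powr (real n * (real n - 1) / (2 * (real n)\<^sup>2))) \<longlonglongrightarrow> 3 * sqrt 3 / 4"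
    unfolding limit [symmetric] by (rule tendsto_powr [OF tendsto_const]) simp
  moreover have "(\<lambda>n. (real n + 1) powr ((3 * real n + 2) / (real n)\<^sup>2)) \<longlonglongrightarrow> 1"
    by real_asymp
  ultimately show "(\<lambda>n. (27 / 16) powr (real n * (real n - 1) / (2 * (real n)\<^sup>2)) * (real n + 1) powr ((3 * real n + 2) / (real n)\<^sup>2))
      \<longlonglongrightarrow> 3 * sqrt 3 / 4"
    using tendsto_mult by fastforce
qed

end
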